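(* Let $F/K$ be a field extension, and let $L, M$ be fields between $K$ and $F$ such that both $L/K$ and $F/M$ are finite. Let $|\cdot|_L$ and $|\cdot|_M$ be absolute values on $L$ and $M$ respectively which extend the same absolute value $|\cdot|_K$ on $K$. Let $\mathcal{E}$ be the set of all $M$-algebra embeddings $\alpha\colon F \to \widehat{M}^a$ for which there exists a $\widehat K$-algebra embedding $\beta\colon\widehat L\to\widehat{M}^a$ such that $\alpha$ and $\beta$ have the same restriction to $L$. Then there is a canonical bijection between (1) the set of absolute values on $F$ which extend both $|\cdot|_L$ and $|\cdot|_M$, and (2) the set of equivalence classes of $\mathcal E$ up to composition with elements of $\operatorname{Aut}_{\widehat M}(\widehat{M}^a)$.
   Context: $\widehat{K},\widehat{L},\widehat{M}$ denote the completions of $K,L,M$ with respect to $|\cdot|_K,|\cdot|_L,|\cdot|_M$, and $\widehat{M}^a$ is an algebraic closure of $\widehat{M}$. By the universal property of completions there are unique absolute-value-preserving $K$-algebra embeddings $\widehat K\to\widehat L$ and $\widehat K\to\widehat M$; these give $\widehat L$ and $\widehat{M}^a$ their $\widehat K$-algebra structures. The absolute value on $\widehat M$ has a unique extension to $\widehat{M}^a$. The canonical bijection is the one sending the class of $\alpha\in\mathcal E$ to the absolute value on $F$ obtained by restricting the absolute value of $\widehat{M}^a$ along $\alpha$. *)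

theory Defs
  imports "HOL-Algebra.Algebraic_Closure" "HOL-Analysis.Abstract_Metric_Spaces"
begin

section \<open>Absolute values on fields\<close>

text \<open>Only the values on the carrier matter. The trivial absolute value is allowed, and no
  distinction is made between the archimedean and the non-archimedean case.\<close>

definition absolute_value :: "('a, 'm) ring_scheme \<Rightarrow> ('a \<Rightarrow> real) \<Rightarrow> bool" where
  "absolute_value R v \<longleftrightarrow>
     (\<forall>x\<in>carrier R. 0 \<le> v x \<and> (v x = 0 \<longleftrightarrow> x = \<zero>\<^bsub>R\<^esub>)) \<and>
     (\<forall>x\<in>carrier R. \<forall>y\<in>carrier R. v (x \<otimes>\<^bsub>R\<^esub> y) = v x * v y) \<and>
     (\<forall>x\<in>carrier R. \<forall>y\<in>carrier R. v (x \<oplus>\<^bsub>R\<^esub> y) \<le> v x + v y)"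

text \<open>The value off the carrier is set to 0 because \<^locale>\<open>Metric_space\<close> asks for
  non-negativity and symmetry at all arguments.\<close>

definition abs_dist :: "('a, 'm) ring_scheme \<Rightarrow> ('a \<Rightarrow> real) \<Rightarrow> 'a \<Rightarrow> 'a \<Rightarrow> real" where
  "abs_dist R v x y = (if x \<in> carrier R \<and> y \<in> carrier R then v (x \<ominus>\<^bsub>R\<^esub> y) else 0)"

lemma Metric_space_abs_dist:
  assumes "field R" and v: "absolute_value R v"
  shows "Metric_space (carrier R) (abs_dist R v)"
proof -
  interpret field R by fact
  have mult: "v (x \<otimes>\<^bsub>R\<^esub> y) = v x * v y" if "x \<in> carrier R" "y \<in> carrier R" for x y
    using v that unfolding absolute_value_def by blast
  have add: "v (x \<oplus>\<^bsub>R\<^esub> y) \<le> v x + v y" if "x \<in> carrier R" "y \<in> carrier R" for x y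
    using v that unfolding absolute_value_def by blast
  have nn: "0 \<le> v x" and z: "v x = 0 \<longleftrightarrow> x = \<zero>\<^bsub>R\<^esub>" if "x \<in> carrier R" for x
    using v that unfolding absolute_value_def by blast+
  have "(\<ominus>\<^bsub>R\<^esub> \<one>\<^bsub>R\<^esub>) \<otimes>\<^bsub>R\<^esub> (\<ominus>\<^bsub>R\<^esub> \<one>\<^bsub>R\<^esub>) = \<one>\<^bsub>R\<^esub>" 
    by (simp add: l_minus)
  then have "v (\<ominus>\<^bsub>R\<^esub> \<one>\<^bsub>R\<^esub>) * v (\<ominus>\<^bsub>R\<^esub> \<one>\<^bsub>R\<^esub>) = v \<one>\<^bsub>R\<^esub>"
    using mult[of "\<ominus>\<^bsub>R\<^esub> \<one>\<^bsub>R\<^esub>" "\<ominus>\<^bsub>R\<^esub> \<one>\<^bsub>R\<^esub>"] by simp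
  moreover have "v \<one>\<^bsub>R\<^esub> = 1"
    using mult[of "\<one>\<^bsub>R\<^esub>" "\<one>\<^bsub>R\<^esub>"] z[of "\<one>\<^bsub>R\<^esub>"] by auto
  ultimately have m1: "v (\<ominus>\<^bsub>R\<^esub> \<one>\<^bsub>R\<^esub>) = 1"
    using nn[of "\<ominus>\<^bsub>R\<^esub> \<one>\<^bsub>R\<^esub>"] by (simp add: square_eq_1_iff)
  have neg: "v (\<ominus>\<^bsub>R\<^esub> x) = v x" if "x \<in> carrier R" for x
    using mult[of "\<ominus>\<^bsub>R\<^esub> \<one>\<^bsub>R\<^esub>" x] that by (simp add: m1 l_minus)
  show ?thesis
  proof
    show "0 \<le> abs_dist R v x y" for x y
      by (simp add: abs_dist_def nn)
    show "abs_dist R v x y = abs_dist R v y x" for x y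
      using neg[of "x \<ominus>\<^bsub>R\<^esub> y"] by (auto simp: abs_dist_def a_minus_def minus_add a_comm)
    show "(abs_dist R v x y = 0) = (x = y)" if "x \<in> carrier R" "y \<in> carrier R" for x y
      using that by (auto simp: abs_dist_def z)
    show "abs_dist R v x u \<le> abs_dist R v x y + abs_dist R v y u"
      if "x \<in> carrier R" "y \<in> carrier R" "u \<in> carrier R" for x y u
    proof -
      have "x \<ominus>\<^bsub>R\<^esub> u = (x \<ominus>\<^bsub>R\<^esub> y) \<oplus>\<^bsub>R\<^esub> (y \<ominus>\<^bsub>R\<^esub> u)"
        using that by (simp add: a_minus_def a_assoc r_neg1)
      then show ?thesis
        using that add[of "x \<ominus>\<^bsub>R\<^esub> y" "y \<ominus>\<^bsub>R\<^esub> u"] by (simp add: abs_dist_def)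
    qed
  qed
qed


section \<open>Completions\<close>

text \<open>A completion of $(R, v)$ is a complete valued field together with an isometric embedding
  of $R$ with dense image; it is determined up to a unique isomorphism by its universal
  property.\<close>

definition is_completion ::
  "('a, 'm) ring_scheme \<Rightarrow> ('a \<Rightarrow> real) \<Rightarrow> ('b, 'n) ring_scheme \<Rightarrow> ('b \<Rightarrow> real) \<Rightarrow> ('a \<Rightarrow> 'b) \<Rightarrow> bool"
where
  "is_completion R v R' v' \<iota> \<longleftrightarrow>
     field R' \<and> absolute_value R' v' \<and>
     Metric_space.mcomplete (carrier R') (abs_dist R' v') \<and>
     \<iota> \<in> ring_hom R R' \<and> (\<forall>x\<in>carrier R. v' (\<iota> x) = v x) \<and>
     Metric_space.mtopology (carrier R') (abs_dist R' v') closure_of (\<iota> ` carrier R) = carrier R'"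


section \<open>Embeddings\<close>

text \<open>The algebra structures of \<open>A\<close> and \<open>B\<close> over a ring with carrier \<open>S\<close> are given by the
  structure maps \<open>f\<close> and \<open>g\<close>. A ring homomorphism between fields preserves 1, hence is injective.
  Maps are extensional, so that equality of embeddings is equality on the carrier of \<open>A\<close>.\<close>

definition algebra_embeddings ::
  "'s set \<Rightarrow> ('s \<Rightarrow> 'a) \<Rightarrow> ('a, 'm) ring_scheme \<Rightarrow> ('s \<Rightarrow> 'b) \<Rightarrow> ('b, 'n) ring_scheme \<Rightarrow> ('a \<Rightarrow> 'b) set"
where
  "algebra_embeddings S f A g B =
     {h \<in> ring_hom A B \<inter> extensional (carrier A). \<forall>c\<in>S. h (f c) = g c}"

definition algebra_automorphisms ::
  "'s set \<Rightarrow> ('s \<Rightarrow> 'a) \<Rightarrow> ('a, 'm) ring_scheme \<Rightarrow> ('a \<Rightarrow> 'a) set"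
where
  "algebra_automorphisms S f A = {\<sigma> \<in> ring_iso A A. \<forall>c\<in>S. \<sigma> (f c) = f c}"

text \<open>Two maps with values in \<open>A\<close> (and common domain \<open>D\<close>) are related if they differ by
  an algebra automorphism of \<open>A\<close>.\<close>

definition conjugacy ::
  "'x set \<Rightarrow> 's set \<Rightarrow> ('s \<Rightarrow> 'a) \<Rightarrow> ('a, 'm) ring_scheme \<Rightarrow> ('x \<Rightarrow> 'a) set \<Rightarrow> (('x \<Rightarrow> 'a) \<times> ('x \<Rightarrow> 'a)) set"
where
  "conjugacy D S f A E =
     {(\<alpha>, \<alpha>'). \<alpha> \<in> E \<and> \<alpha>' \<in> E \<and>
        (\<exists>\<sigma>\<in>algebra_automorphisms S f A. \<forall>x\<in>D. \<alpha>' x = \<sigma> (\<alpha> x))}"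

lemma equiv_conjugacy:
  assumes A: "ring A" and f: "f ` S \<subseteq> carrier A"
    and E: "\<And>\<alpha> x. \<alpha> \<in> E \<Longrightarrow> x \<in> D \<Longrightarrow> \<alpha> x \<in> carrier A"
  shows "equiv E (conjugacy D S f A E)"
proof (rule equivI)
  show "conjugacy D S f A E \<subseteq> E \<times> E"
    by (auto simp: conjugacy_def)
  have "id \<in> algebra_automorphisms S f A"
    by (simp add: algebra_automorphisms_def ring_iso_def ring_hom_def)
  then show "refl_on E (conjugacy D S f A E)"
    unfolding refl_on_def conjugacy_def by (auto intro!: bexI[of _ id])
  show "sym (conjugacy D S f A E)"
  proof (rule symI)
    fix \<alpha> \<alpha>' assume "(\<alpha>, \<alpha>') \<in> conjugacy D S f A E"
    then obtain \<sigma> where \<sigma>: "\<sigma> \<in> ring_iso A A" "\<forall>c\<in>S. \<sigma> (f c) = f c"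
      and \<alpha>: "\<alpha> \<in> E" "\<alpha>' \<in> E" "\<forall>x\<in>D. \<alpha>' x = \<sigma> (\<alpha> x)"
      by (auto simp: conjugacy_def algebra_automorphisms_def)
    define \<tau> where "\<tau> = inv_into (carrier A) \<sigma>"
    have inj: "inj_on \<sigma> (carrier A)"
      using \<sigma> by (auto simp: ring_iso_def bij_betw_def)
    then have left: "\<tau> (\<sigma> y) = y" if "y \<in> carrier A" for y
      using that by (simp add: \<tau>_def)
    have "\<tau> \<in> ring_iso A A"
      using ring_iso_set_sym[OF A \<sigma>(1)] by (simp add: \<tau>_def)
    moreover have "\<tau> (f c) = f c" if "c \<in> S" for c
    proof -
      have "\<tau> (f c) = \<tau> (\<sigma> (f c))" using \<sigma> that by simp
      also have "\<dots> = f c" using left f that by blast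
      finally show ?thesis .
    qed
    moreover have "\<forall>x\<in>D. \<alpha> x = \<tau> (\<alpha>' x)"
      using \<alpha> E left by simp
    ultimately show "(\<alpha>', \<alpha>) \<in> conjugacy D S f A E"
      using \<alpha> by (auto simp: conjugacy_def algebra_automorphisms_def)
  qed
  show "trans (conjugacy D S f A E)"
  proof (rule transI)
    fix \<alpha> \<alpha>' \<alpha>'' assume "(\<alpha>, \<alpha>') \<in> conjugacy D S f A E" "(\<alpha>', \<alpha>'') \<in> conjugacy D S f A E"
    then obtain \<sigma> \<tau> where st: "\<sigma> \<in> algebra_automorphisms S f A" "\<tau> \<in> algebra_automorphisms S f A"
      and \<alpha>: "\<alpha> \<in> E" "\<alpha>'' \<in> E" "\<forall>x\<in>D. \<alpha>'' x = (\<tau> \<circ> \<sigma>) (\<alpha> x)"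
      by (auto simp: conjugacy_def)
    have "\<tau> \<circ> \<sigma> \<in> algebra_automorphisms S f A"
      using st by (auto simp: algebra_automorphisms_def intro: ring_iso_set_trans)
    then show "(\<alpha>, \<alpha>'') \<in> conjugacy D S f A E"
      using \<alpha> unfolding conjugacy_def by blast
  qed
qed

end

theory Submission
  imports Defs
begin

text \<open>An embedding \<open>\<alpha>\<close> of \<open>F\<close> into the algebraic closure \<open>\<Omega>\<close> of the completion \<open>Mh\<close> pulls the absolute
value of \<open>\<Omega>\<close> back to \<open>F\<close>. The theorem rests on four general facts.

\<^item> An absolute value on a complete field has at most one extension to an algebraic element
(\<open>absolute_value_unique_on_algebraic\<close>), because norms on finite-dimensional spaces over a complete
field are equivalent and such spaces are complete. The last point also shows that \<open>Lh\<close> is finite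
over \<open>Kh\<close> and spanned by \<open>L\<close> (\<open>finite_extension_of_dense_image\<close>).

\<^item> Homomorphisms into an algebraically closed field extend along algebraic extensions
(\<open>hom_extends_to_algebraic_elements\<close>).

\<^item> Isometric homomorphisms extend to limits (\<open>isometric_extension_to_closure\<close>).

\<^item> A valued field embeds into a valued domain in which its Cauchy sequences converge
(\<open>exists_domain_of_Cauchy_limits\<close>).

Given these, the argument is as follows. The pulled back absolute value extends that of \<open>M\<close> by the
choice of \<open>\<alpha>\<close>, and that of \<open>L\<close> because \<open>\<alpha>\<close> agrees on \<open>L\<close> with some embedding \<open>\<beta>\<close> of \<open>Lh\<close> over
\<open>Kh\<close>, which is isometric by uniqueness. An automorphism of \<open>\<Omega>\<close> over \<open>Mh\<close> is isometric for the same
reason, so the absolute value depends only on the class of \<open>\<alpha>\<close>. If two embeddings induce the same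
absolute value, the isometry between their images extends to the part of the closure that
contains \<open>Mh\<close>, then to \<open>\<Omega>\<close>, and this is an automorphism over \<open>Mh\<close> that relates them. Finally, given an
absolute value \<open>v\<close> on \<open>F\<close> that extends those of \<open>L\<close> and \<open>M\<close>, the limits of Cauchy sequences for \<open>v\<close>
provide a domain that contains both \<open>F\<close> and \<open>Mh\<close>; there \<open>F\<close> is algebraic over \<open>Mh\<close>, so it embeds
into \<open>\<Omega>\<close> over \<open>Mh\<close>, and uniqueness shows that this embedding induces \<open>v\<close>. Since it is isometric on \<open>L\<close>,
it extends to an embedding of \<open>Lh\<close>.\<close>

section \<open>Absolute values, Cauchy sequences and completeness\<close>

locale valued_domain = domain R for R (structure) +
  fixes v :: "'a \<Rightarrow> real"
  assumes abs_val: "absolute_value R v"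
begin

lemma v_nonneg: "x \<in> carrier R \<Longrightarrow> 0 \<le> v x"
  and v_eq_0_iff: "x \<in> carrier R \<Longrightarrow> v x = 0 \<longleftrightarrow> x = \<zero>"
  and v_mult: "x \<in> carrier R \<Longrightarrow> y \<in> carrier R \<Longrightarrow> v (x \<otimes> y) = v x * v y"
  and v_add: "x \<in> carrier R \<Longrightarrow> y \<in> carrier R \<Longrightarrow> v (x \<oplus> y) \<le> v x + v y"
  using abs_val unfolding absolute_value_def by blast+

lemma v_zero: "v \<zero> = 0"
  using v_eq_0_iff by simp

lemma v_one: "v \<one> = 1"
  using v_mult[of \<one> \<one>] v_eq_0_iff[of \<one>] by simp

lemma v_neg: "x \<in> carrier R \<Longrightarrow> v (\<ominus> x) = v x"
proof -
  have "v (\<ominus> \<one>) * v (\<ominus> \<one>) = 1"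
    using v_mult[of "\<ominus> \<one>" "\<ominus> \<one>"] v_one by (simp add: l_minus)
  then have "v (\<ominus> \<one>) = 1"
    using v_nonneg[of "\<ominus> \<one>"] by (simp add: square_eq_1_iff)
  moreover assume "x \<in> carrier R"
  ultimately show ?thesis
    using v_mult[of "\<ominus> \<one>" x] by (simp add: l_minus)
qed

lemma v_minus_commute: "x \<in> carrier R \<Longrightarrow> y \<in> carrier R \<Longrightarrow> v (x \<ominus> y) = v (y \<ominus> x)"
  using v_neg[of "x \<ominus> y"] by (simp add: a_minus_def minus_add a_comm)

lemma v_triangle:
  assumes "x \<in> carrier R" "y \<in> carrier R" "z \<in> carrier R"
  shows "v (x \<ominus> z) \<le> v (x \<ominus> y) + v (y \<ominus> z)"
proof -
  have "x \<ominus> z = (x \<ominus> y) \<oplus> (y \<ominus> z)"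
    using assms by algebra
  then show ?thesis
    using v_add[of "x \<ominus> y" "y \<ominus> z"] assms by simp
qed

lemma v_diff_le: 
  assumes "x \<in> carrier R" "y \<in> carrier R"
  shows "\<bar>v x - v y\<bar> \<le> v (x \<ominus> y)"
proof -
  have "x = (x \<ominus> y) \<oplus> y" "y = (y \<ominus> x) \<oplus> x"
    using assms by algebra+
  then have "v x \<le> v (x \<ominus> y) + v y" "v y \<le> v (y \<ominus> x) + v x"
    using v_add[of "x \<ominus> y" y] v_add[of "y \<ominus> x" x] assms by simp_all
  then show ?thesis
    using v_minus_commute[OF assms] by simp
qed

end

text \<open>Completeness is phrased by sequences in a subset of an ambient ring, and the difference is the
difference of the ambient ring. In this way a subfield, a finite-dimensional subspace and the
whole field are treated by one notion, although only the last one is given as a ring of its own.\<close>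
definition cauchy_in ::
  "('a, 'm) ring_scheme \<Rightarrow> 'a set \<Rightarrow> ('a \<Rightarrow> real) \<Rightarrow> (nat \<Rightarrow> 'a) \<Rightarrow> bool"
where
  "cauchy_in R A w s \<longleftrightarrow>
     (\<forall>n. s n \<in> A) \<and> (\<forall>e>0. \<exists>N. \<forall>m\<ge>N. \<forall>n\<ge>N. w (s m \<ominus>\<^bsub>R\<^esub> s n) < e)"

definition complete_in :: "('a, 'm) ring_scheme \<Rightarrow> 'a set \<Rightarrow> ('a \<Rightarrow> real) \<Rightarrow> bool" where
  "complete_in R A w \<longleftrightarrow>
     (\<forall>s. cauchy_in R A w s \<longrightarrow> (\<exists>l\<in>A. (\<lambda>n. w (s n \<ominus>\<^bsub>R\<^esub> l)) \<longlonglongrightarrow> 0))"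

lemma completion_complete_in:
  assumes "is_completion R v R' v' \<iota>"
  shows "complete_in R' (carrier R') v'"
  unfolding complete_in_def
proof (intro allI impI)
  fix s assume s: "cauchy_in R' (carrier R') v' s"
  have R': "field R'" "absolute_value R' v'"
    and compl: "Metric_space.mcomplete (carrier R') (abs_dist R' v')"
    using assms by (auto simp: is_completion_def)
  interpret M: Metric_space "carrier R'" "abs_dist R' v'"
    using Metric_space_abs_dist[OF R'] .
  have sc: "s n \<in> carrier R'" for n
    using s by (simp add: cauchy_in_def)
  have "M.MCauchy s"
    using s by (auto simp: M.MCauchy_def cauchy_in_def abs_dist_def)
  then obtain l where "limitin M.mtopology s l sequentially"
    using compl by (auto simp: M.mcomplete_def)
  then have "l \<in> carrier R'" "(\<lambda>n. abs_dist R' v' (s n) l) \<longlonglongrightarrow> 0"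
    by (auto simp: M.limitin_metric_dist_null)
  then show "\<exists>l\<in>carrier R'. (\<lambda>n. v' (s n \<ominus>\<^bsub>R'\<^esub> l)) \<longlonglongrightarrow> 0"
    using sc by (auto simp: abs_dist_def)
qed

lemma completion_dense:
  assumes "is_completion R v R' v' \<iota>" "y \<in> carrier R'" "0 < (e::real)"
  shows "\<exists>x\<in>carrier R. v' (y \<ominus>\<^bsub>R'\<^esub> \<iota> x) < e"
proof -
  have R': "field R'" "absolute_value R' v'"
    using assms(1) by (auto simp: is_completion_def)
  interpret M: Metric_space "carrier R'" "abs_dist R' v'"
    using Metric_space_abs_dist[OF R'] .
  have "y \<in> M.mtopology closure_of (\<iota> ` carrier R)"
    using assms(1,2) by (auto simp: is_completion_def)
  then obtain x where "x \<in> carrier R" "\<iota> x \<in> carrier R'" "abs_dist R' v' y (\<iota> x) < e"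
    using assms(3) by (auto simp: M.metric_closure_of)
  then show ?thesis
    using assms(2) by (auto simp: abs_dist_def)
qed

lemma (in ring_hom_ring) hom_minus:
  "x \<in> carrier R \<Longrightarrow> y \<in> carrier R \<Longrightarrow> h (x \<ominus> y) = h x \<ominus>\<^bsub>S\<^esub> h y"
  by (simp add: a_minus_def)

lemma (in ring) subring_minus:
  "subring K R \<Longrightarrow> x \<in> K \<Longrightarrow> y \<in> K \<Longrightarrow> x \<ominus> y \<in> K"
  by (simp add: a_minus_def subringE(5,7))

lemma (in ring_hom_ring) complete_in_image:
  assumes "subring K R" and "complete_in R K v" and isom: "\<And>x. x \<in> K \<Longrightarrow> w (h x) = v x"
  shows "complete_in S (h ` K) w"
  unfolding complete_in_def
proof (intro allI impI)
  fix s assume s: "cauchy_in S (h ` K) w s"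
  have KR: "K \<subseteq> carrier R" using subringE(1)[OF assms(1)] .
  have "\<forall>n. \<exists>x. x \<in> K \<and> h x = s n"
    using s by (auto simp: cauchy_in_def image_iff) metis
  then obtain t where t: "\<And>n. t n \<in> K" "\<And>n. h (t n) = s n" by metis
  have eq: "w (s m \<ominus>\<^bsub>S\<^esub> h y) = v (t m \<ominus> y)" if "y \<in> K" for m y
    using isom[OF R.subring_minus[OF assms(1) t(1) that]] hom_minus[of "t m" y] t(2)
      subsetD[OF KR t(1)[of m]] subsetD[OF KR that] by metis
  then have "w (s m \<ominus>\<^bsub>S\<^esub> s n) = v (t m \<ominus> t n)" for m n
    using t by metis
  then have "cauchy_in R K v t"
    using s t(1) by (simp add: cauchy_in_def)
  then obtain l where "l \<in> K" "(\<lambda>n. v (t n \<ominus> l)) \<longlonglongrightarrow> 0"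
    using assms(2) by (auto simp: complete_in_def)
  then show "\<exists>l\<in>h ` K. (\<lambda>n. w (s n \<ominus>\<^bsub>S\<^esub> l)) \<longlonglongrightarrow> 0"
    using eq by auto
qed

text \<open>Subtraction in \<open>R\<lparr>carrier := D\<rparr>\<close> takes inverses in another monoid, so it is a different term from
subtraction in \<open>R\<close>. Both are determined by addition, which the two rings share.\<close>
lemma hom_minus_on_subring:
  assumes R: "ring R" and S: "ring S" and D: "subring D R" and h: "h \<in> ring_hom (R\<lparr>carrier := D\<rparr>) S"
    and x: "x \<in> D" and y: "y \<in> D"
  shows "h (x \<ominus>\<^bsub>R\<^esub> y) = h x \<ominus>\<^bsub>S\<^esub> h y"
proof -
  interpret R: ring R by fact
  interpret S: ring S by fact
  interpret h: ring_hom_ring "R\<lparr>carrier := D\<rparr>" S h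
    using R.subring_is_ring[OF D] S h by (rule ring_hom_ringI2)
  have d: "x \<ominus>\<^bsub>R\<^esub> y \<in> D" using R.subring_minus[OF D x y] .
  have "(x \<ominus>\<^bsub>R\<^esub> y) \<oplus>\<^bsub>R\<^esub> y = x"
    using subsetD[OF subringE(1)[OF D] x] subsetD[OF subringE(1)[OF D] y]
    by (simp add: a_minus_def R.a_assoc R.l_neg)
  then have eq: "h (x \<ominus>\<^bsub>R\<^esub> y) \<oplus>\<^bsub>S\<^esub> h y = h x"
    using h.hom_add[of "x \<ominus>\<^bsub>R\<^esub> y" y] d y by simp
  have c: "h (x \<ominus>\<^bsub>R\<^esub> y) \<in> carrier S" "h x \<in> carrier S" "h y \<in> carrier S"
    using h.hom_closed d x y by simp_all
  show ?thesis unfolding eq[symmetric] using c(1,3) by (simp add: a_minus_def S.a_assoc S.r_neg)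
qed

lemma ring_hom_restrict:
  "h \<in> ring_hom R S \<Longrightarrow> D \<subseteq> carrier R \<Longrightarrow> h \<in> ring_hom (R\<lparr>carrier := D\<rparr>) S"
  by (auto simp: ring_hom_def subset_iff)

lemma absolute_value_pullback:
  assumes R: "field R" and S: "field S" and h: "h \<in> ring_hom R S" and v: "absolute_value S v"
  shows "absolute_value R (\<lambda>x. v (h x))"
proof -
  interpret R: field R by fact
  interpret S: field S by fact
  interpret h: ring_hom_ring R S h using R.ring_axioms S.ring_axioms h by (rule ring_hom_ringI2)
  interpret S: valued_domain S v
    using v by (simp add: valued_domain_def valued_domain_axioms_def S.domain_axioms)
  have "inj_on h (carrier R)" using non_trivial_field_hom_is_inj[OF h R S] .
  then have "h x = \<zero>\<^bsub>S\<^esub> \<longleftrightarrow> x = \<zero>\<^bsub>R\<^esub>" if "x \<in> carrier R" for x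
    using that h.hom_zero R.zero_closed by (metis inj_onD)
  then show ?thesis
    unfolding absolute_value_def
    by (auto simp: S.v_nonneg S.v_eq_0_iff S.v_mult S.v_add)
qed

lemma absolute_value_restrict:
  "absolute_value R v \<Longrightarrow> D \<subseteq> carrier R \<Longrightarrow> absolute_value (R\<lparr>carrier := D\<rparr>) v"
  by (auto simp: absolute_value_def subset_iff)

section \<open>Norms on finite-dimensional spaces over a complete field\<close>

lemma tendsto_0_squeeze:
  fixes f g :: "nat \<Rightarrow> real"
  assumes "\<And>n. 0 \<le> f n" "\<And>n. f n \<le> g n" "g \<longlonglongrightarrow> 0"
  shows "f \<longlonglongrightarrow> 0"
  using tendsto_sandwich[of "\<lambda>_. 0" f sequentially g 0] assms by simp

text \<open>A subspace \<open>V\<close> of a ring extension of \<open>K\<close>, with a norm \<open>w\<close> over the valued field \<open>(K, c)\<close>.\<close>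
locale normed_subspace = domain R for R (structure) +
  fixes K :: "'a set" and c :: "'a \<Rightarrow> real" and V :: "'a set" and w :: "'a \<Rightarrow> real"
  assumes K: "subfield K R" and abs_K: "absolute_value (R\<lparr>carrier := K\<rparr>) c"
    and V_carrier: "V \<subseteq> carrier R" and V_zero: "\<zero> \<in> V"
    and V_add: "x \<in> V \<Longrightarrow> y \<in> V \<Longrightarrow> x \<oplus> y \<in> V"
    and V_neg: "x \<in> V \<Longrightarrow> \<ominus> x \<in> V"
    and V_smult: "a \<in> K \<Longrightarrow> x \<in> V \<Longrightarrow> a \<otimes> x \<in> V"
    and w_nonneg: "x \<in> V \<Longrightarrow> 0 \<le> w x"
    and w_eq_0: "x \<in> V \<Longrightarrow> w x = 0 \<Longrightarrow> x = \<zero>"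
    and w_smult: "a \<in> K \<Longrightarrow> x \<in> V \<Longrightarrow> w (a \<otimes> x) = c a * w x"
    and w_add: "x \<in> V \<Longrightarrow> y \<in> V \<Longrightarrow> w (x \<oplus> y) \<le> w x + w y"
begin

sublocale c: valued_domain "R\<lparr>carrier := K\<rparr>" c
  using subring_is_domain[OF subfieldE(1)[OF K]] abs_K
  by (simp add: valued_domain_def valued_domain_axioms_def)

lemmas K_subring = subringE[OF subfieldE(1)[OF K]]

lemma c_neg_one: "c (\<ominus> \<one>) = 1"
proof -
  have "\<ominus> \<one> \<in> K" using K_subring by blast
  then have "c (\<ominus> \<one>) * c (\<ominus> \<one>) = 1"
    using c.v_mult[of "\<ominus> \<one>" "\<ominus> \<one>"] c.v_one by (simp add: l_minus)
  then show ?thesis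
    using c.v_nonneg[of "\<ominus> \<one>"] \<open>\<ominus> \<one> \<in> K\<close> by (simp add: square_eq_1_iff)
qed

lemma w_neg: "x \<in> V \<Longrightarrow> w (\<ominus> x) = w x"
proof -
  assume x: "x \<in> V"
  have "\<ominus> \<one> \<in> K" using K_subring by blast
  then show ?thesis
    using w_smult[of "\<ominus> \<one>" x] c_neg_one x subsetD[OF V_carrier x] by (simp add: l_minus)
qed

lemma V_minus: "x \<in> V \<Longrightarrow> y \<in> V \<Longrightarrow> x \<ominus> y \<in> V"
  by (simp add: a_minus_def V_add V_neg)

lemma w_minus: "x \<in> V \<Longrightarrow> y \<in> V \<Longrightarrow> w (x \<ominus> y) \<le> w x + w y"
  using w_add[of x "\<ominus> y"] by (simp add: a_minus_def V_neg w_neg)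

end

lemma (in domain) normed_subspace_subset:
  assumes "normed_subspace R K c V' w" "dimension n K V" "V \<subseteq> V'"
  shows "normed_subspace R K c V w"
proof -
  interpret V': normed_subspace R K c V' w by fact
  note p = space_subgroup_props[OF V'.K assms(2)]
  have sub: "x \<in> V'" if "x \<in> V" for x using assms(3) that by blast
  show ?thesis
  proof (intro normed_subspace.intro normed_subspace_axioms.intro domain_axioms)
    show "subfield K R" "absolute_value (R\<lparr>carrier := K\<rparr>) c" using V'.K V'.abs_K .
    show "V \<subseteq> carrier R" "\<zero> \<in> V" using p(1,2) .
  qed (simp_all add: p(3-5) sub V'.w_nonneg V'.w_eq_0 V'.w_smult V'.w_add)
qed

lemma (in ring) dimension_SucE:
  assumes K: "subfield K R" and V: "dimension (Suc n) K V"
  obtains a W where "a \<in> carrier R" "a \<notin> W" "dimension n K W" "V = line_extension K a W"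
    "W \<subseteq> V" "a \<in> V"
proof -
  obtain a W where a: "a \<in> carrier R" "a \<notin> W" and W: "dimension n K W"
    and V: "V = line_extension K a W"
    using dimension_backwards[OF K V] by auto
  note Wp = space_subgroup_props[OF K W]
  have WV: "W \<subseteq> V"
  proof
    fix u assume u: "u \<in> W"
    then have "u = \<zero> \<otimes> a \<oplus> u" using a Wp(1) by auto
    then show "u \<in> V" using V u subringE(2)[OF subfieldE(1)[OF K]] by (auto simp: line_extension_mem_iff)
  qed
  have "a \<in> V"
  proof -
    have "a = \<one> \<otimes> a \<oplus> \<zero>" using a by simp
    then show ?thesis
      using V Wp(2) subringE(3)[OF subfieldE(1)[OF K]] by (auto simp: line_extension_mem_iff)
  qed
  then show thesis using that a W V WV by blast
qed

text \<open>If \<open>W\<close> is complete, then a vector \<open>a\<close> outside \<open>W\<close> has positive distance \<open>\<delta>\<close> from \<open>W\<close>: vectors of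
\<open>W\<close> with \<open>w (a \<oplus> u)\<close> tending to 0 form a Cauchy sequence, and its limit would be \<open>\<ominus> a\<close>.
Scaling gives the bound for all multiples of \<open>a\<close>. So the coordinate along \<open>a\<close> is a bounded
functional, which drives both inductions below. Scaling uses only inverses in \<open>K\<close>, so the trivial
absolute value is covered as well.\<close>
lemma (in normed_subspace) coordinate_bound:
  assumes W: "dimension n K W" "complete_in R W w" and a: "a \<in> V" "a \<notin> W" and WV: "W \<subseteq> V"
  shows "\<exists>\<delta>>0. \<forall>k\<in>K. \<forall>u\<in>W. c k * \<delta> \<le> w (k \<otimes> a \<oplus> u)"
proof -
  interpret W: normed_subspace R K c W w
    using normed_subspace_subset[OF normed_subspace_axioms W(1) WV] .
  have aR: "a \<in> carrier R" using a V_carrier by auto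
  have "\<exists>\<delta>>0. \<forall>u\<in>W. \<delta> \<le> w (a \<oplus> u)"
  proof (rule ccontr)
    assume neg: "\<not> ?thesis"
    have "\<exists>u\<in>W. w (a \<oplus> u) < 1 / real (Suc n)" for n
    proof (rule ccontr)
      assume "\<not> ?thesis"
      then have "\<forall>u\<in>W. 1 / real (Suc n) \<le> w (a \<oplus> u)" by (auto simp: not_less)
      with neg show False by (meson of_nat_0_less_iff zero_less_Suc zero_less_divide_1_iff)
    qed
    then obtain s where s: "\<And>n. s n \<in> W" "\<And>n. w (a \<oplus> s n) < 1 / real (Suc n)" by metis
    have sV: "s n \<in> V" "s n \<in> carrier R" for n using s(1) WV V_carrier by auto
    have "cauchy_in R W w s"
      unfolding cauchy_in_def
    proof (intro conjI allI impI)
      fix e :: real assume "0 < e"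
      then obtain N where N: "1 / real (Suc N) < e / 2"
        using nat_approx_posE[of "e / 2"] by auto
      have "w (s m \<ominus> s n) < e" if "m \<ge> N" "n \<ge> N" for m n
      proof -
        have "s m \<ominus> s n = (a \<oplus> s m) \<ominus> (a \<oplus> s n)" using aR sV(2)[of m] sV(2)[of n] by algebra
        then have "w (s m \<ominus> s n) \<le> w (a \<oplus> s m) + w (a \<oplus> s n)"
          using w_minus[of "a \<oplus> s m" "a \<oplus> s n"] V_add a sV by simp
        also have "\<dots> < 1 / real (Suc m) + 1 / real (Suc n)" using s(2)[of m] s(2)[of n] by simp
        also have "\<dots> \<le> 1 / real (Suc N) + 1 / real (Suc N)"
          using that by (intro add_mono divide_left_mono) auto
        finally show ?thesis using N by simp
      qed
      then show "\<exists>N. \<forall>m\<ge>N. \<forall>n\<ge>N. w (s m \<ominus> s n) < e" by blast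
    qed (rule s(1))
    then obtain l where l: "l \<in> W" "(\<lambda>n. w (s n \<ominus> l)) \<longlonglongrightarrow> 0"
      using W(2) by (auto simp: complete_in_def)
    have lV: "l \<in> V" "l \<in> carrier R" using l(1) WV V_carrier by auto
    have "w (a \<oplus> l) \<le> 1 / real (Suc n) + w (s n \<ominus> l)" for n
    proof -
      have "a \<oplus> l = (a \<oplus> s n) \<ominus> (s n \<ominus> l)" using aR lV sV(2)[of n] by algebra
      then show ?thesis
        using w_minus[of "a \<oplus> s n" "s n \<ominus> l"] s(2)[of n] V_add V_minus a sV lV by simp
    qed
    moreover have "(\<lambda>n. 1 / real (Suc n) + w (s n \<ominus> l)) \<longlonglongrightarrow> 0 + 0"
      by (intro tendsto_add l(2) lim_1_over_n[THEN LIMSEQ_Suc])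
    ultimately have "w (a \<oplus> l) \<le> 0"
      by (intro LIMSEQ_le_const[of _ 0]) auto
    then have "a \<oplus> l = \<zero>" using w_nonneg[of "a \<oplus> l"] w_eq_0[of "a \<oplus> l"] V_add a lV by force
    then have "a = \<ominus> l" using aR lV by (metis minus_equality)
    then show False using a(2) W.V_neg[OF l(1)] by simp
  qed
  then obtain \<delta> where \<delta>: "\<delta> > 0" "\<And>u. u \<in> W \<Longrightarrow> \<delta> \<le> w (a \<oplus> u)" by blast
  have "c k * \<delta> \<le> w (k \<otimes> a \<oplus> u)" if k: "k \<in> K" and u: "u \<in> W" for k u
  proof (cases "k = \<zero>")
    case True
    then have "c k = 0" using c.v_zero by simp
    moreover have "0 \<le> w (k \<otimes> a \<oplus> u)" using V_add V_smult a k u WV w_nonneg by auto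
    ultimately show ?thesis by simp
  next
    case False
    then have inv: "inv k \<in> K" "k \<otimes> inv k = \<one>" using subfield_m_inv[OF K, of k] k by auto
    have "k \<in> carrier R" "inv k \<in> carrier R" "u \<in> carrier R"
      using k inv K_subring(1) u WV V_carrier by auto
    then have "k \<otimes> a \<oplus> u = k \<otimes> (a \<oplus> inv k \<otimes> u)"
      using aR inv(2) by (simp add: r_distr flip: m_assoc)
    moreover have "inv k \<otimes> u \<in> W" using W.V_smult inv u by blast
    ultimately have "w (k \<otimes> a \<oplus> u) = c k * w (a \<oplus> inv k \<otimes> u)"
      using w_smult[OF k, of "a \<oplus> inv k \<otimes> u"] V_add a WV by auto
    then show ?thesis using \<delta>(2)[OF \<open>inv k \<otimes> u \<in> W\<close>] c.v_nonneg[of k] k by (simp add: mult_left_mono)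
  qed
  with \<delta>(1) show ?thesis by blast
qed

text \<open>By induction on the dimension: by the coordinate bound, both coordinates of a Cauchy sequence in
the line extension \<open>K a + W\<close> are Cauchy sequences.\<close>
lemma (in domain) finite_dimension_complete:
  assumes K: "complete_in R K c"
  shows "dimension n K V \<Longrightarrow> normed_subspace R K c V w \<Longrightarrow> complete_in R V w"
proof (induction n arbitrary: V)
  case 0
  interpret V: normed_subspace R K c V w by fact
  have "V = {\<zero>}" using dimension_zero[OF V.K 0(1)] .
  moreover have "w \<zero> = 0" using V.w_smult[of \<zero> \<zero>] V.V_zero V.K_subring(2) V.c.v_zero by simp
  ultimately show ?case
    by (auto simp: complete_in_def cauchy_in_def a_minus_def)
next
  case (Suc n)
  interpret V: normed_subspace R K c V w by fact
  obtain a W where a: "a \<in> carrier R" "a \<notin> W" and W: "dimension n K W"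
    and V: "V = line_extension K a W" and WV: "W \<subseteq> V" and aV: "a \<in> V"
    by (rule dimension_SucE[OF V.K Suc.prems(1)])
  note Wp = space_subgroup_props[OF V.K W]
  interpret W: normed_subspace R K c W w
    using normed_subspace_subset[OF Suc.prems(2) W WV] .
  have Wc: "complete_in R W w" using Suc.IH[OF W W.normed_subspace_axioms] .
  obtain \<delta> where \<delta>: "\<delta> > 0" "\<And>k u. k \<in> K \<Longrightarrow> u \<in> W \<Longrightarrow> c k * \<delta> \<le> w (k \<otimes> a \<oplus> u)"
    using V.coordinate_bound[OF W Wc aV a(2) WV] by blast
  show ?case unfolding complete_in_def
  proof (intro allI impI)
    fix s assume s: "cauchy_in R V w s"
    then have "\<forall>n. \<exists>k u. k \<in> K \<and> u \<in> W \<and> s n = k \<otimes> a \<oplus> u"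
      using V by (fastforce simp: cauchy_in_def line_extension_mem_iff)
    then obtain k u where ku: "\<And>n. k n \<in> K" "\<And>n. u n \<in> W" "\<And>n. s n = k n \<otimes> a \<oplus> u n" by metis
    have kR: "k n \<in> carrier R" "u n \<in> carrier R" for n using ku V.K_subring(1) Wp(1) by auto
    have kd: "k m \<ominus> k n \<in> K" for m n using subring_minus[OF subfieldE(1)[OF V.K]] ku by blast
    have ud: "u m \<ominus> u n \<in> W" for m n using W.V_minus ku by blast
    have sd: "s m \<ominus> s n = (k m \<ominus> k n) \<otimes> a \<oplus> (u m \<ominus> u n)" for m n
      using kR[of m] kR[of n] a(1) unfolding ku(3) by algebra
    have "c (k m \<ominus> k n) * \<delta> \<le> w (s m \<ominus> s n)" for m n
      using \<delta>(2)[OF kd ud, of m n m n] sd[of m n] by simp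
    then have kle: "c (k m \<ominus> k n) \<le> w (s m \<ominus> s n) / \<delta>" for m n
      using \<delta>(1) by (simp add: pos_le_divide_eq)
    have ule: "w (u m \<ominus> u n) \<le> (1 + w a / \<delta>) * w (s m \<ominus> s n)" for m n
    proof -
      have sV: "s m \<ominus> s n \<in> V" using V.V_minus s by (simp add: cauchy_in_def)
      have "u m \<ominus> u n = (s m \<ominus> s n) \<ominus> (k m \<ominus> k n) \<otimes> a"
        using kR[of m] kR[of n] a(1) unfolding sd by algebra
      then have "w (u m \<ominus> u n) \<le> w (s m \<ominus> s n) + c (k m \<ominus> k n) * w a"
        using V.w_minus[OF sV V.V_smult[OF kd aV], of m n] V.w_smult[OF kd aV, of m n] by simp
      also have "\<dots> \<le> w (s m \<ominus> s n) + w (s m \<ominus> s n) / \<delta> * w a"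
        using mult_right_mono[OF kle[of m n] V.w_nonneg[OF aV]] by simp
      finally show ?thesis by (simp add: algebra_simps)
    qed
    have scale: "\<exists>N. \<forall>m\<ge>N. \<forall>n\<ge>N. f m n < e"
      if f: "\<And>m n. f m n \<le> C * w (s m \<ominus> s n)" and C: "C > 0" and e: "e > 0"
      for f :: "nat \<Rightarrow> nat \<Rightarrow> real" and C e
    proof -
      have "e / C > 0" using C e by simp
      then obtain N where "\<forall>m\<ge>N. \<forall>n\<ge>N. w (s m \<ominus> s n) < e / C"
        using s unfolding cauchy_in_def by blast
      then have "\<forall>m\<ge>N. \<forall>n\<ge>N. C * w (s m \<ominus> s n) < e" using C by (simp add: pos_less_divide_eq mult.commute)
      then show ?thesis using f by (meson le_less_trans)
    qed
    have "cauchy_in R K c k"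
      unfolding cauchy_in_def using ku(1) scale[of "\<lambda>m n. c (k m \<ominus> k n)" "1 / \<delta>"] kle \<delta>(1) by simp
    then obtain k0 where k0: "k0 \<in> K" "(\<lambda>n. c (k n \<ominus> k0)) \<longlonglongrightarrow> 0"
      using K by (auto simp: complete_in_def)
    have "1 + w a / \<delta> > 0" using V.w_nonneg[OF aV] \<delta>(1) by (simp add: add_pos_nonneg)
    then have "cauchy_in R W w u"
      unfolding cauchy_in_def using ku(2) scale[of "\<lambda>m n. w (u m \<ominus> u n)" "1 + w a / \<delta>"] ule by simp
    then obtain u0 where u0: "u0 \<in> W" "(\<lambda>n. w (u n \<ominus> u0)) \<longlonglongrightarrow> 0"
      using Wc by (auto simp: complete_in_def)
    let ?l = "k0 \<otimes> a \<oplus> u0"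
    have l: "?l \<in> V" using V k0 u0 by (auto simp: line_extension_mem_iff)
    have l0: "k0 \<in> carrier R" "u0 \<in> carrier R" using k0 u0 V.K_subring(1) Wp(1) by auto
    have upper: "w (s n \<ominus> ?l) \<le> c (k n \<ominus> k0) * w a + w (u n \<ominus> u0)" for n
    proof -
      have kd: "k n \<ominus> k0 \<in> K" using subring_minus[OF subfieldE(1)[OF V.K]] ku k0 by blast
      have ud: "u n \<ominus> u0 \<in> V" using W.V_minus ku u0 WV by blast
      have "s n \<ominus> ?l = (k n \<ominus> k0) \<otimes> a \<oplus> (u n \<ominus> u0)"
        using kR[of n] l0 a(1) unfolding ku(3) by algebra
      then show ?thesis
        using V.w_add[OF V.V_smult[OF kd aV] ud] V.w_smult[OF kd aV] by simp
    qed
    have lim: "(\<lambda>n. c (k n \<ominus> k0) * w a + w (u n \<ominus> u0)) \<longlonglongrightarrow> 0"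
      using tendsto_add[OF tendsto_mult_right[OF k0(2), of "w a"] u0(2)] by simp
    have lower: "0 \<le> w (s n \<ominus> ?l)" for n
      using V.w_nonneg V.V_minus l s by (simp add: cauchy_in_def)
    have "(\<lambda>n. w (s n \<ominus> ?l)) \<longlonglongrightarrow> 0"
      using lower upper lim by (rule tendsto_0_squeeze)
    then show "\<exists>l\<in>V. (\<lambda>n. w (s n \<ominus> l)) \<longlonglongrightarrow> 0" using l by blast
  qed
qed

text \<open>The classical theorem that all norms on a finite-dimensional space over a complete field are
equivalent, in one direction; exchanging the two norms gives the other one.\<close>
lemma (in domain) finite_dimension_norms_equivalent:
  assumes K: "complete_in R K c"
  shows "dimension n K V \<Longrightarrow> normed_subspace R K c V w \<Longrightarrow> normed_subspace R K c V w' \<Longrightarrow>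
    \<exists>C. \<forall>x\<in>V. w' x \<le> C * w x"
proof (induction n arbitrary: V)
  case 0
  interpret V': normed_subspace R K c V w' by fact
  have "V = {\<zero>}" using dimension_zero[OF V'.K 0(1)] .
  moreover have "w' \<zero> = 0" using V'.w_smult[of \<zero> \<zero>] V'.V_zero V'.K_subring(2) V'.c.v_zero by simp
  ultimately show ?case by (intro exI[of _ 0]) simp
next
  case (Suc n)
  interpret V: normed_subspace R K c V w by fact
  interpret V': normed_subspace R K c V w' by fact
  obtain a W where a: "a \<in> carrier R" "a \<notin> W" and W: "dimension n K W"
    and V: "V = line_extension K a W" and WV: "W \<subseteq> V" and aV: "a \<in> V"
    by (rule dimension_SucE[OF V.K Suc.prems(1)])
  have nW: "normed_subspace R K c W w" "normed_subspace R K c W w'"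
    using normed_subspace_subset[OF _ W WV] Suc.prems by blast+
  obtain \<delta> where \<delta>: "\<delta> > 0" "\<And>k u. k \<in> K \<Longrightarrow> u \<in> W \<Longrightarrow> c k * \<delta> \<le> w (k \<otimes> a \<oplus> u)"
    using V.coordinate_bound[OF W finite_dimension_complete[OF K W nW(1)] aV a(2) WV] by blast
  obtain C where C: "\<And>x. x \<in> W \<Longrightarrow> w' x \<le> C * w x"
    using Suc.IH[OF W nW] by blast
  \<comment> \<open>For \<open>x = k \<otimes> a \<oplus> u\<close> the bound \<open>B\<close> adds the contribution of \<open>c k \<le> w x / \<delta>\<close> to that of
    \<open>w u \<le> w x + c k * w a\<close>; the absolute value is taken because \<open>C\<close> may be negative if \<open>W\<close> is zero.\<close>
  define B where "B = w' a / \<delta> + \<bar>C\<bar> * (1 + w a / \<delta>)"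
  have "w' x \<le> B * w x" if xV: "x \<in> V" for x
  proof -
    obtain k u where k: "k \<in> K" and u: "u \<in> W" and x: "x = k \<otimes> a \<oplus> u"
      using xV unfolding V line_extension_mem_iff by blast
    have uV: "u \<in> V" using u WV by blast
    have kaV: "k \<otimes> a \<in> V" using V.V_smult k aV by blast
    have ck: "c k \<le> w x / \<delta>" using \<delta>(2)[OF k u] \<delta>(1) x by (simp add: pos_le_divide_eq)
    have "u = x \<ominus> k \<otimes> a"
      using subsetD[OF V.V_carrier uV] subsetD[OF V.V_carrier kaV] unfolding x by algebra
    then have "w u \<le> w x + c k * w a"
      using V.w_minus[OF xV kaV] V.w_smult[OF k aV] by simp
    also have "\<dots> \<le> w x + w x / \<delta> * w a"
      using mult_right_mono[OF ck V.w_nonneg[OF aV]] by simp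
    finally have wu: "w u \<le> (1 + w a / \<delta>) * w x" by (simp add: algebra_simps)
    have "w' x \<le> c k * w' a + w' u"
      using V'.w_add[OF kaV uV] V'.w_smult[OF k aV] x by simp
    also have "\<dots> \<le> w x / \<delta> * w' a + \<bar>C\<bar> * w u"
      using ck V'.w_nonneg[OF aV] C[OF u] V.w_nonneg[OF uV]
      by (intro add_mono mult_right_mono order_trans[OF C[OF u]]) auto
    also have "\<dots> \<le> w x / \<delta> * w' a + \<bar>C\<bar> * ((1 + w a / \<delta>) * w x)"
      using wu by (intro add_left_mono mult_left_mono) auto
    finally show ?thesis by (simp add: B_def algebra_simps)
  qed
  then show ?case by blast
qed

section \<open>Uniqueness of the extension of an absolute value\<close>

lemma le_if_powers_le_const:
  fixes a b C :: real
  assumes "0 \<le> a" "0 < b" and le: "\<And>n. a ^ n \<le> C * b ^ n"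
  shows "a \<le> b"
proof (rule ccontr)
  assume "\<not> a \<le> b"
  then have "1 < a / b" using assms by simp
  then obtain n where "C < (a / b) ^ n" using real_arch_pow by blast
  then have "C * b ^ n < a ^ n" using assms(2) by (simp add: power_divide pos_less_divide_eq)
  with le[of n] show False by simp
qed

lemma (in domain) absolute_value_normed_subspace:
  assumes K: "subfield K R" and D: "subring D R" "K \<subseteq> D"
    and w: "absolute_value (R\<lparr>carrier := D\<rparr>) w" and c: "\<And>x. x \<in> K \<Longrightarrow> w x = c x"
  shows "normed_subspace R K c D w"
proof -
  have sub: "x \<in> D" if "x \<in> K" for x using D(2) that by blast
  have "absolute_value (R\<lparr>carrier := K\<rparr>) w"
    using w sub by (auto simp: absolute_value_def)
  then have "absolute_value (R\<lparr>carrier := K\<rparr>) c"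
    using subringE(6,7)[OF subfieldE(1)[OF K]] c by (auto simp: absolute_value_def)
  then show ?thesis
  proof (intro normed_subspace.intro normed_subspace_axioms.intro domain_axioms K)
    show "x = \<zero>" if "x \<in> D" "w x = 0" for x
      using w that by (simp add: absolute_value_def)
  qed (use w sub c subringE(1,2,5-7)[OF D(1)] in \<open>simp_all add: absolute_value_def\<close>)
qed

text \<open>On the finite-dimensional space \<open>K(x)\<close> the two absolute values are equivalent norms, say
\<open>w' y \<le> C * w y\<close> for all \<open>y\<close>. Applying this to all powers \<open>y = x ^ n\<close> and taking \<open>n\<close>-th roots
removes the constant, because both are multiplicative.\<close>
theorem (in domain) absolute_value_unique_on_algebraic:
  assumes K: "subfield K R" and compl: "complete_in R K c"
    and D: "subring D R" "K \<subseteq> D"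
    and w: "absolute_value (R\<lparr>carrier := D\<rparr>) w" "\<And>x. x \<in> K \<Longrightarrow> w x = c x"
    and w': "absolute_value (R\<lparr>carrier := D\<rparr>) w'" "\<And>x. x \<in> K \<Longrightarrow> w' x = c x"
    and x: "x \<in> D" "(algebraic over K) x"
  shows "w' x = w x"
proof -
  have xR: "x \<in> carrier R" using x(1) subringE(1)[OF D(1)] by blast
  let ?S = "simple_extension K x"
  have S: "subring ?S R" "K \<subseteq> ?S" "?S \<subseteq> D" "x \<in> ?S"
    using simple_extension_is_subring[OF subfieldE(1)[OF K] xR]
      simple_extension_incl[OF subfieldE(3)[OF K] xR]
      simple_extension_subring_incl[OF D x(1)] simple_extension_mem[OF subfieldE(1)[OF K] xR] by auto
  have dim: "dimension (degree (Irr K x)) K ?S"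
    using dimension_simple_extension[OF K xR x(2)] .
  have le: "w2 x \<le> w1 x"
    if w1: "absolute_value (R\<lparr>carrier := D\<rparr>) w1" "\<And>x. x \<in> K \<Longrightarrow> w1 x = c x"
    and w2: "absolute_value (R\<lparr>carrier := D\<rparr>) w2" "\<And>x. x \<in> K \<Longrightarrow> w2 x = c x" for w1 w2
  proof (cases "x = \<zero>")
    case True
    then show ?thesis using w1(1) w2(1) x(1) by (auto simp: absolute_value_def)
  next
    case False
    have V: "valued_domain (R\<lparr>carrier := D\<rparr>) w1" "valued_domain (R\<lparr>carrier := D\<rparr>) w2"
      using subring_is_domain[OF D(1)] w1 w2 by (simp_all add: valued_domain_def valued_domain_axioms_def)
    interpret w1: valued_domain "R\<lparr>carrier := D\<rparr>" w1 by fact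
    interpret w2: valued_domain "R\<lparr>carrier := D\<rparr>" w2 by fact
    obtain C where C: "\<And>y. y \<in> ?S \<Longrightarrow> w2 y \<le> C * w1 y"
      using finite_dimension_norms_equivalent[OF compl dim
          normed_subspace_subset[OF absolute_value_normed_subspace[OF K D w1] dim S(3)]
          normed_subspace_subset[OF absolute_value_normed_subspace[OF K D w2] dim S(3)]] by blast
    have pow: "x [^] n \<in> ?S \<and> w1 (x [^] n) = w1 x ^ n \<and> w2 (x [^] n) = w2 x ^ n" for n :: nat
    proof (induction n)
      case 0
      then show ?case using w1.v_one w2.v_one subringE(3)[OF S(1)] by simp
    next
      case (Suc n)
      then have "x [^] n \<in> D" using S(3) by blast
      with Suc show ?case
        using w1.v_mult[of "x [^] n" x] w2.v_mult[of "x [^] n" x] x(1) subringE(6)[OF S(1) _ S(4)]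
        by simp
    qed
    have "w1 x > 0" using w1.v_nonneg[of x] w1.v_eq_0_iff[of x] x(1) False by force
    moreover have "w2 x \<ge> 0" using w2.v_nonneg[of x] x(1) by simp
    moreover have "w2 x ^ n \<le> C * w1 x ^ n" for n using C[of "x [^] n"] pow[of n] by simp
    ultimately show ?thesis using le_if_powers_le_const by blast
  qed
  show ?thesis using le[OF w w'] le[OF w' w] by simp
qed

section \<open>Extension of homomorphisms to algebraic elements\<close>

text \<open>The graph of a ring homomorphism to \<open>S\<close> from some subfield of \<open>R\<close>. All clauses are closure
conditions on finitely many elements, so they pass to unions of chains, and the order of
extension between partial homomorphisms is inclusion. The last clause makes \<open>G\<close> single-valued,
because \<open>G\<close> is closed under differences.\<close>
definition hom_graph :: "('a, 'm) ring_scheme \<Rightarrow> ('b, 'n) ring_scheme \<Rightarrow> ('a \<times> 'b) set \<Rightarrow> bool" where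
  "hom_graph R S G \<longleftrightarrow>
     G \<subseteq> carrier R \<times> carrier S \<and> (\<one>\<^bsub>R\<^esub>, \<one>\<^bsub>S\<^esub>) \<in> G \<and>
     (\<forall>x y. (x, y) \<in> G \<longrightarrow> (\<ominus>\<^bsub>R\<^esub> x, \<ominus>\<^bsub>S\<^esub> y) \<in> G) \<and>
     (\<forall>x y x' y'. (x, y) \<in> G \<longrightarrow> (x', y') \<in> G \<longrightarrow>
        (x \<oplus>\<^bsub>R\<^esub> x', y \<oplus>\<^bsub>S\<^esub> y') \<in> G \<and> (x \<otimes>\<^bsub>R\<^esub> x', y \<otimes>\<^bsub>S\<^esub> y') \<in> G) \<and>
     (\<forall>x y. (x, y) \<in> G \<longrightarrow> x \<noteq> \<zero>\<^bsub>R\<^esub> \<longrightarrow> (\<exists>z\<in>fst ` G. x \<otimes>\<^bsub>R\<^esub> z = \<one>\<^bsub>R\<^esub>)) \<and>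
     (\<forall>y. (\<zero>\<^bsub>R\<^esub>, y) \<in> G \<longrightarrow> y = \<zero>\<^bsub>S\<^esub>)"

lemma hom_graphD:
  assumes "hom_graph R S G"
  shows "G \<subseteq> carrier R \<times> carrier S" and "(\<one>\<^bsub>R\<^esub>, \<one>\<^bsub>S\<^esub>) \<in> G"
    and "(x, y) \<in> G \<Longrightarrow> (\<ominus>\<^bsub>R\<^esub> x, \<ominus>\<^bsub>S\<^esub> y) \<in> G"
    and "(x, y) \<in> G \<Longrightarrow> (x', y') \<in> G \<Longrightarrow> (x \<oplus>\<^bsub>R\<^esub> x', y \<oplus>\<^bsub>S\<^esub> y') \<in> G"
    and "(x, y) \<in> G \<Longrightarrow> (x', y') \<in> G \<Longrightarrow> (x \<otimes>\<^bsub>R\<^esub> x', y \<otimes>\<^bsub>S\<^esub> y') \<in> G"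
    and "(x, y) \<in> G \<Longrightarrow> x \<noteq> \<zero>\<^bsub>R\<^esub> \<Longrightarrow> \<exists>z\<in>fst ` G. x \<otimes>\<^bsub>R\<^esub> z = \<one>\<^bsub>R\<^esub>"
    and "(\<zero>\<^bsub>R\<^esub>, y) \<in> G \<Longrightarrow> y = \<zero>\<^bsub>S\<^esub>"
  using assms unfolding hom_graph_def by blast+

lemma hom_graph_of_hom:
  assumes R: "domain R" and S: "ring S" and D: "subfield D R" and h: "h \<in> ring_hom (R\<lparr>carrier := D\<rparr>) S"
  shows "hom_graph R S ((\<lambda>x. (x, h x)) ` D)"
proof -
  interpret R: domain R by fact
  interpret S: ring S by fact
  note D' = subringE[OF subfieldE(1)[OF D]]
  interpret h: ring_hom_ring "R\<lparr>carrier := D\<rparr>" S h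
    using R.subring_is_ring[OF subfieldE(1)[OF D]] S.ring_axioms h by (rule ring_hom_ringI2)
  have add: "h (x \<oplus>\<^bsub>R\<^esub> y) = h x \<oplus>\<^bsub>S\<^esub> h y" and mult: "h (x \<otimes>\<^bsub>R\<^esub> y) = h x \<otimes>\<^bsub>S\<^esub> h y"
    if "x \<in> D" "y \<in> D" for x y
    using that h.hom_add[of x y] h.hom_mult[of x y] by simp_all
  have neg: "h (\<ominus>\<^bsub>R\<^esub> x) = \<ominus>\<^bsub>S\<^esub> h x" if "x \<in> D" for x
  proof -
    have "h (\<ominus>\<^bsub>R\<^esub> x) \<oplus>\<^bsub>S\<^esub> h x = \<zero>\<^bsub>S\<^esub>"
      using add[of "\<ominus>\<^bsub>R\<^esub> x" x] D'(5)[OF that] that D'(1) h.hom_zero R.l_neg by (simp add: subset_iff)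
    then show ?thesis
      using S.minus_equality[of "h (\<ominus>\<^bsub>R\<^esub> x)" "h x"] D'(5)[OF that] that h.hom_closed by simp
  qed
  have inv: "\<exists>z\<in>D. x \<otimes>\<^bsub>R\<^esub> z = \<one>\<^bsub>R\<^esub>" if "x \<in> D" "x \<noteq> \<zero>\<^bsub>R\<^esub>" for x
    using R.subfield_m_inv[OF D, of x] that by blast
  show ?thesis
    unfolding hom_graph_def using D' h.hom_closed h.hom_one h.hom_zero add mult neg inv
    by (auto simp: image_iff subset_iff)
qed

lemma hom_graphE:
  assumes R: "domain R" and S: "ring S" and G: "hom_graph R S G"
  obtains D h where "subfield D R" "h \<in> ring_hom (R\<lparr>carrier := D\<rparr>) S" "G = (\<lambda>x. (x, h x)) ` D"
proof -
  interpret R: domain R by fact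
  interpret S: ring S by fact
  define D where "D = fst ` G"
  define h where "h x = (SOME y. (x, y) \<in> G)" for x
  have hG: "(x, h x) \<in> G" if "x \<in> D" for x
    using that unfolding D_def h_def by (auto intro: someI)
  note hg = hom_graphD[OF G]
  note GRS = hg(1) and one = hg(2) and neg = hg(3) and add = hg(4) and mult = hg(5) and inv = hg(6) and zero = hg(7)
  have uniq: "y = y'" if "(x, y) \<in> G" "(x, y') \<in> G" for x y y'
  proof -
    have c: "x \<in> carrier R" "y \<in> carrier S" "y' \<in> carrier S" using that GRS by auto
    have "(x \<oplus>\<^bsub>R\<^esub> (\<ominus>\<^bsub>R\<^esub> x), y \<oplus>\<^bsub>S\<^esub> (\<ominus>\<^bsub>S\<^esub> y')) \<in> G"
      using add neg that by blast
    then have "y \<oplus>\<^bsub>S\<^esub> (\<ominus>\<^bsub>S\<^esub> y') = \<zero>\<^bsub>S\<^esub>" using zero c R.r_neg by simp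
    then show ?thesis using c by (simp add: S.r_right_minus_eq flip: a_minus_def)
  qed
  have hI: "h x = y" if "(x, y) \<in> G" for x y
    using uniq[OF hG[of x] that] that by (force simp: D_def)
  have Dsub: "subring D R"
  proof (rule R.subringI)
    show "D \<subseteq> carrier R" using GRS by (auto simp: D_def)
    show "\<one>\<^bsub>R\<^esub> \<in> D" using one by (force simp: D_def)
    show "\<ominus>\<^bsub>R\<^esub> x \<in> D" if "x \<in> D" for x using neg[OF hG[OF that]] by (force simp: D_def)
    show "x \<otimes>\<^bsub>R\<^esub> y \<in> D" if "x \<in> D" "y \<in> D" for x y
      using mult[OF hG[OF that(1)] hG[OF that(2)]] by (force simp: D_def)
    show "x \<oplus>\<^bsub>R\<^esub> y \<in> D" if "x \<in> D" "y \<in> D" for x y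
      using add[OF hG[OF that(1)] hG[OF that(2)]] by (force simp: D_def)
  qed
  have "h \<in> ring_hom (R\<lparr>carrier := D\<rparr>) S"
  proof (rule ring_hom_memI)
    show "h x \<in> carrier S" if "x \<in> carrier (R\<lparr>carrier := D\<rparr>)" for x
      using hG[of x] that GRS by auto
  qed (use hG hI[OF one] hI[OF add] hI[OF mult] in simp_all)
  moreover have "subfield D R"
  proof (rule R.subfieldI)
    show "subcring D R" using R.subcringI'[OF Dsub] .
    show "Units (R\<lparr>carrier := D\<rparr>) = D - {\<zero>\<^bsub>R\<^esub>}"
    proof
      show "Units (R\<lparr>carrier := D\<rparr>) \<subseteq> D - {\<zero>\<^bsub>R\<^esub>}"
        using subringE(1)[OF Dsub] by (auto simp: Units_def)
      show "D - {\<zero>\<^bsub>R\<^esub>} \<subseteq> Units (R\<lparr>carrier := D\<rparr>)"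
      proof
        fix x assume x: "x \<in> D - {\<zero>\<^bsub>R\<^esub>}"
        then obtain z where "z \<in> D" "x \<otimes>\<^bsub>R\<^esub> z = \<one>\<^bsub>R\<^esub>"
          using inv[OF hG[of x]] by (auto simp: D_def)
        moreover from this have "z \<otimes>\<^bsub>R\<^esub> x = \<one>\<^bsub>R\<^esub>"
          using x subringE(1)[OF Dsub] R.m_comm[of z x] by auto
        ultimately show "x \<in> Units (R\<lparr>carrier := D\<rparr>)"
          using x by (auto simp: Units_def)
      qed
    qed
  qed
  moreover have "G = (\<lambda>x. (x, h x)) ` D"
    using hG hI by (force simp: D_def image_iff)
  ultimately show thesis using that by blast
qed

lemma hom_graph_Union:
  assumes "subset.chain {G. hom_graph R S G} C" "C \<noteq> {}"
  shows "hom_graph R S (\<Union>C)"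
proof -
  have C: "hom_graph R S G" if "G \<in> C" for G
    using assms(1) that by (auto simp: subset.chain_def)
  have two: "\<exists>G\<in>C. p \<in> G \<and> q \<in> G" if pq: "p \<in> \<Union>C" "q \<in> \<Union>C" for p q
  proof -
    obtain G1 G2 where g: "G1 \<in> C" "p \<in> G1" "G2 \<in> C" "q \<in> G2" using pq by blast
    then have "G1 \<subseteq> G2 \<or> G2 \<subseteq> G1" using assms(1) by (auto simp: subset.chain_def)
    with g show ?thesis by blast
  qed
  have closed: "(x \<oplus>\<^bsub>R\<^esub> x', y \<oplus>\<^bsub>S\<^esub> y') \<in> \<Union>C" "(x \<otimes>\<^bsub>R\<^esub> x', y \<otimes>\<^bsub>S\<^esub> y') \<in> \<Union>C"
    if xy: "(x, y) \<in> \<Union>C" "(x', y') \<in> \<Union>C" for x y x' y'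
  proof -
    obtain G where "G \<in> C" "(x, y) \<in> G" "(x', y') \<in> G" using two[OF xy] by blast
    then show "(x \<oplus>\<^bsub>R\<^esub> x', y \<oplus>\<^bsub>S\<^esub> y') \<in> \<Union>C" "(x \<otimes>\<^bsub>R\<^esub> x', y \<otimes>\<^bsub>S\<^esub> y') \<in> \<Union>C"
      using hom_graphD(4,5)[OF C] by blast+
  qed
  show ?thesis
    unfolding hom_graph_def
  proof (intro conjI allI impI)
    show "\<Union>C \<subseteq> carrier R \<times> carrier S" using hom_graphD(1)[OF C] by blast
    show "(\<one>\<^bsub>R\<^esub>, \<one>\<^bsub>S\<^esub>) \<in> \<Union>C" using hom_graphD(2)[OF C] assms(2) by blast
    show "(\<ominus>\<^bsub>R\<^esub> x, \<ominus>\<^bsub>S\<^esub> y) \<in> \<Union>C" if "(x, y) \<in> \<Union>C" for x y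
      using that hom_graphD(3)[OF C] by blast
    show "\<exists>z\<in>fst ` \<Union>C. x \<otimes>\<^bsub>R\<^esub> z = \<one>\<^bsub>R\<^esub>" if xy: "(x, y) \<in> \<Union>C" "x \<noteq> \<zero>\<^bsub>R\<^esub>" for x y
    proof -
      obtain G where G: "G \<in> C" "(x, y) \<in> G" using xy by blast
      then show ?thesis using hom_graphD(6)[OF C[OF G(1)] G(2) xy(2)] by blast
    qed
    show "y = \<zero>\<^bsub>S\<^esub>" if "(\<zero>\<^bsub>R\<^esub>, y) \<in> \<Union>C" for y
      using that hom_graphD(7)[OF C] by blast
  qed (use closed in blast)+
qed

lemma (in algebraically_closed) exists_root_of_nonconstant:
  assumes "p \<in> carrier (poly_ring L)" "degree p > 0"
  obtains y where "y \<in> carrier L" "eval p y = \<zero>"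
proof -
  have "size (roots p) > 0"
    using roots_over_carrier[OF assms(1)] assms(2) by (simp add: splitted_def)
  then obtain y where "y \<in># roots p" by (metis multiset_nonemptyE size_empty less_irrefl)
  then show thesis using that roots_mem_iff_is_root[OF assms(1)] by (auto simp: is_root_def)
qed

text \<open>Let \<open>p\<close> be the minimal polynomial of \<open>x\<close> over \<open>D\<close>, and \<open>y\<close> a root in \<open>S\<close> of the polynomial obtained
by applying \<open>h\<close> to the coefficients of \<open>p\<close>. A polynomial \<open>q\<close> over \<open>D\<close> with root \<open>x\<close> is a multiple
of \<open>p\<close>, so its image has root \<open>y\<close>; therefore \<open>q(x)\<close> may be sent to the value at \<open>y\<close> of the image
of \<open>q\<close>. The result is stated for graphs, as the extension step for Zorn's lemma.\<close>
lemma hom_extends_to_simple_extension: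
  assumes R: "domain R" and S: "algebraically_closed S"
    and D: "subfield D R" and h: "h \<in> ring_hom (R\<lparr>carrier := D\<rparr>) S"
    and x: "x \<in> carrier R" "((ring.algebraic R) over D) x"
  shows "\<exists>G. hom_graph R S G \<and> (\<lambda>x. (x, h x)) ` D \<subseteq> G \<and> x \<in> fst ` G"
proof -
  interpret R: domain R by fact
  interpret S: algebraically_closed S by fact
  note Dr = subfieldE(1)[OF D]
  have fD: "field (R\<lparr>carrier := D\<rparr>)" using R.subfield_iff(2)[OF D] .
  interpret h: ring_hom_ring "R\<lparr>carrier := D\<rparr>" S h
    using R.subring_is_ring[OF Dr] S.ring_axioms h by (rule ring_hom_ringI2)
  interpret UP: ring "D[X]\<^bsub>R\<^esub>" using R.univ_poly_is_ring[OF Dr] .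
  let ?p = "R.Irr D x"
  note Irr = R.IrrE[OF D x]
  have poly_eq: "poly_ring (R\<lparr>carrier := D\<rparr>) = D[X]\<^bsub>R\<^esub>"
    using R.univ_poly_consistent[OF Dr] by simp
  have map_poly: "map h q \<in> carrier (poly_ring S)" if "q \<in> carrier (D[X]\<^bsub>R\<^esub>)" for q
    using polynomial_hom[OF h fD S.field_axioms] that poly_eq by simp
  have "degree ?p > 0"
    using R.pirreducible_degree[OF D Irr(1,2)] by simp
  then obtain y where y: "y \<in> carrier S" "S.eval (map h ?p) y = \<zero>\<^bsub>S\<^esub>"
    using S.exists_root_of_nonconstant[OF map_poly[OF Irr(1)]] by auto
  let ?e = "\<lambda>q. R.eval q x" and ?f = "\<lambda>q. S.eval (map h q) y"
  have setD: "set q \<subseteq> D" if "q \<in> carrier (D[X]\<^bsub>R\<^esub>)" for q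
    using that R.polynomial_incl unfolding univ_poly_carrier[symmetric] by blast
  have setS: "set (map h q) \<subseteq> carrier S" if "set q \<subseteq> D" for q
    using that h.hom_closed by auto
  have e: "ring_hom_ring (D[X]\<^bsub>R\<^esub>) R ?e" using R.eval_ring_hom[OF Dr x(1)] .
  interpret e: ring_hom_ring "D[X]\<^bsub>R\<^esub>" R ?e by fact
  have f_norm: "S.eval (S.normalize (map h q)) y = ?f q" if "set q \<subseteq> D" for q
    using S.eval_normalize[OF setS[OF that] y(1)] .
  have f: "?f \<in> ring_hom (D[X]\<^bsub>R\<^esub>) S"
  proof (rule ring_hom_memI)
    fix p q assume p: "p \<in> carrier (D[X]\<^bsub>R\<^esub>)" and q: "q \<in> carrier (D[X]\<^bsub>R\<^esub>)"
    note pq = setD[OF p] setD[OF q]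
    show "?f p \<in> carrier S" using S.eval_in_carrier[OF setS[OF pq(1)] y(1)] .
    have "?f (p \<oplus>\<^bsub>D[X]\<^bsub>R\<^esub>\<^esub> q) = S.eval (S.poly_add (map h p) (map h q)) y"
      using f_norm[OF setD[OF UP.a_closed[OF p q]]] h.poly_add_hom'[of p q] pq
      by (simp add: univ_poly_def R.poly_add_consistent[OF Dr] del: R.poly_add.simps S.poly_add.simps)
    then show "?f (p \<oplus>\<^bsub>D[X]\<^bsub>R\<^esub>\<^esub> q) = ?f p \<oplus>\<^bsub>S\<^esub> ?f q"
      using S.eval_poly_add[OF setS[OF pq(1)] setS[OF pq(2)] y(1)] by simp
    have "?f (p \<otimes>\<^bsub>D[X]\<^bsub>R\<^esub>\<^esub> q) = S.eval (S.poly_mult (map h p) (map h q)) y"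
      using f_norm[OF setD[OF UP.m_closed[OF p q]]] h.poly_mult_hom'[of p q] pq
      by (simp add: univ_poly_def R.poly_mult_consistent[OF Dr] del: R.poly_mult.simps S.poly_mult.simps)
    then show "?f (p \<otimes>\<^bsub>D[X]\<^bsub>R\<^esub>\<^esub> q) = ?f p \<otimes>\<^bsub>S\<^esub> ?f q"
      using S.eval_poly_mult[OF setS[OF pq(1)] setS[OF pq(2)] y(1)] by simp
  next
    show "?f \<one>\<^bsub>D[X]\<^bsub>R\<^esub>\<^esub> = \<one>\<^bsub>S\<^esub>" using h.hom_one by (simp add: univ_poly_def)
  qed
  interpret f: ring_hom_ring "D[X]\<^bsub>R\<^esub>" S ?f
    using UP.ring_axioms S.ring_axioms f by (rule ring_hom_ringI2)
  define G where "G = (\<lambda>q. (?e q, ?f q)) ` carrier (D[X]\<^bsub>R\<^esub>)"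
  have ext: "R.simple_extension D x = ?e ` carrier (D[X]\<^bsub>R\<^esub>)"
    using R.simple_extension_as_eval_img[OF subfieldE(3)[OF D] x(1)] .
  have fst_G: "fst ` G = R.simple_extension D x" by (auto simp: G_def ext image_image)
  have single: "?f q = \<zero>\<^bsub>S\<^esub>" if q: "q \<in> carrier (D[X]\<^bsub>R\<^esub>)" "?e q = \<zero>\<^bsub>R\<^esub>" for q
  proof -
    have "?p divides\<^bsub>D[X]\<^bsub>R\<^esub>\<^esub> q"
      using R.Irr_minimal[OF D x q] R.pdivides_iff_shell[OF D Irr(1) q(1)] by simp
    then obtain r where r: "r \<in> carrier (D[X]\<^bsub>R\<^esub>)" "q = ?p \<otimes>\<^bsub>D[X]\<^bsub>R\<^esub>\<^esub> r"
      by (auto simp: factor_def)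
    have "?f q = ?f ?p \<otimes>\<^bsub>S\<^esub> ?f r" unfolding r(2) using f.hom_mult[OF Irr(1) r(1)] .
    then show ?thesis using y(2) f.hom_closed[OF r(1)] by simp
  qed
  have sf: "subfield (R.simple_extension D x) R"
    using R.simple_extension_is_subfield[OF D x(1)] x(2) by simp
  have "hom_graph R S G"
    unfolding hom_graph_def
  proof (intro conjI allI impI)
    show "G \<subseteq> carrier R \<times> carrier S" using e.hom_closed f.hom_closed by (auto simp: G_def)
    show "(\<one>\<^bsub>R\<^esub>, \<one>\<^bsub>S\<^esub>) \<in> G"
      unfolding G_def using e.hom_one f.hom_one UP.one_closed by (metis (no_types, lifting) image_eqI)
    show "(\<ominus>\<^bsub>R\<^esub> a, \<ominus>\<^bsub>S\<^esub> b) \<in> G" if ab: "(a, b) \<in> G" for a b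
    proof -
      obtain q where q: "q \<in> carrier (D[X]\<^bsub>R\<^esub>)" "a = ?e q" "b = ?f q" using ab by (auto simp: G_def)
      then show ?thesis
        unfolding G_def using e.hom_a_inv f.hom_a_inv UP.a_inv_closed[OF q(1)]
        by (intro image_eqI[of _ _ "\<ominus>\<^bsub>D[X]\<^bsub>R\<^esub>\<^esub> q"]) auto
    qed
    fix a b a' b' assume "(a, b) \<in> G" "(a', b') \<in> G"
    then obtain q q' where q: "q \<in> carrier (D[X]\<^bsub>R\<^esub>)" "a = ?e q" "b = ?f q"
      and q': "q' \<in> carrier (D[X]\<^bsub>R\<^esub>)" "a' = ?e q'" "b' = ?f q'" by (auto simp: G_def)
    show "(a \<oplus>\<^bsub>R\<^esub> a', b \<oplus>\<^bsub>S\<^esub> b') \<in> G"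
      unfolding G_def q(2,3) q'(2,3) e.hom_add[OF q(1) q'(1), symmetric] f.hom_add[OF q(1) q'(1), symmetric]
      by (rule imageI) (rule UP.a_closed[OF q(1) q'(1)])
    show "(a \<otimes>\<^bsub>R\<^esub> a', b \<otimes>\<^bsub>S\<^esub> b') \<in> G"
      unfolding G_def q(2,3) q'(2,3) e.hom_mult[OF q(1) q'(1), symmetric] f.hom_mult[OF q(1) q'(1), symmetric]
      by (rule imageI) (rule UP.m_closed[OF q(1) q'(1)])
  next
    fix a b assume "(a, b) \<in> G" "a \<noteq> \<zero>\<^bsub>R\<^esub>"
    then have "a \<in> R.simple_extension D x - {\<zero>\<^bsub>R\<^esub>}" using fst_G by force
    then show "\<exists>z\<in>fst ` G. a \<otimes>\<^bsub>R\<^esub> z = \<one>\<^bsub>R\<^esub>"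
      using R.subfield_m_inv[OF sf, of a] fst_G by blast
  next
    fix b assume "(\<zero>\<^bsub>R\<^esub>, b) \<in> G"
    then show "b = \<zero>\<^bsub>S\<^esub>" using single by (auto simp: G_def)
  qed
  moreover have "(\<lambda>x. (x, h x)) ` D \<subseteq> G"
  proof safe
    fix d assume d: "d \<in> D"
    then have dR: "d \<in> carrier R" using subfieldE(3)[OF D] by auto
    have nd: "R.normalize [d] \<in> carrier (D[X]\<^bsub>R\<^esub>)"
      using R.normalize_gives_polynomial[of "[d]" D] d by (simp add: univ_poly_carrier)
    have "?e (R.normalize [d]) = d" using dR x(1) by auto
    moreover have "?f (R.normalize [d]) = h d"
      using h.hom_closed[of d] h.hom_zero d y(1) by auto
    ultimately show "(d, h d) \<in> G" unfolding G_def using nd by (metis (no_types, lifting) image_eqI)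
  qed
  moreover have "x \<in> fst ` G"
    using R.simple_extension_mem[OF Dr x(1)] fst_G by simp
  ultimately show ?thesis by blast
qed

text \<open>The domain \<open>D\<close> of a maximal extension of \<open>h\<close> contains every element of \<open>R\<close> that is algebraic over
\<open>K\<close>, since such an element is algebraic over \<open>D\<close>. \<open>R\<close> may be far from algebraic over \<open>K\<close>, as
when it consists of Cauchy sequences modulo null sequences.\<close>
theorem hom_extends_to_algebraic_elements:
  assumes R: "domain R" and S: "algebraically_closed S"
    and K: "subfield K R" and h: "h \<in> ring_hom (R\<lparr>carrier := K\<rparr>) S"
  obtains D h' where "subfield D R" "h' \<in> ring_hom (R\<lparr>carrier := D\<rparr>) S"
    "K \<subseteq> D" "\<And>x. x \<in> K \<Longrightarrow> h' x = h x"
    "\<And>x. x \<in> carrier R \<Longrightarrow> ((ring.algebraic R) over K) x \<Longrightarrow> x \<in> D"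
proof -
  interpret R: domain R by fact
  interpret S: algebraically_closed S by fact
  let ?G0 = "(\<lambda>x. (x, h x)) ` K"
  define A where "A = {G. hom_graph R S G \<and> ?G0 \<subseteq> G}"
  have G0: "?G0 \<in> A" unfolding A_def using hom_graph_of_hom[OF R S.ring_axioms K h] by simp
  have "\<exists>M\<in>A. \<forall>H\<in>A. M \<subseteq> H \<longrightarrow> H = M"
  proof (rule subset_Zorn_nonempty)
    show "A \<noteq> {}" using G0 by blast
    fix C assume C: "C \<noteq> {}" "subset.chain A C"
    then have "subset.chain {G. hom_graph R S G} C" by (auto simp: subset.chain_def A_def)
    then have "hom_graph R S (\<Union>C)" using hom_graph_Union C(1) by blast
    moreover have "?G0 \<subseteq> G" if "G \<in> C" for G
      using C(2) that by (auto simp: subset.chain_def A_def)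
    ultimately show "\<Union>C \<in> A" unfolding A_def using C(1) by blast
  qed
  then obtain M where "M \<in> A" and max': "\<forall>H\<in>A. M \<subseteq> H \<longrightarrow> H = M" by blast
  then have M: "hom_graph R S M" "?G0 \<subseteq> M" by (simp_all add: A_def)
  have max: "H = M" if "hom_graph R S H" "M \<subseteq> H" for H
    using max' that M(2) unfolding A_def by (metis (mono_tags, lifting) mem_Collect_eq subset_trans)
  obtain D h' where D: "subfield D R" and h': "h' \<in> ring_hom (R\<lparr>carrier := D\<rparr>) S"
    and MD: "M = (\<lambda>x. (x, h' x)) ` D"
    using hom_graphE[OF R S.ring_axioms M(1)] .
  have KD: "K \<subseteq> D" and hh: "\<And>x. x \<in> K \<Longrightarrow> h' x = h x" using M(2) unfolding MD by auto
  show thesis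
  proof (rule that[OF D h' KD hh])
    fix x assume x: "x \<in> carrier R" "((ring.algebraic R) over K) x"
    then have "((ring.algebraic R) over D) x" using R.algebraic_mono[OF KD] by blast
    then obtain G where G: "hom_graph R S G" "M \<subseteq> G" "x \<in> fst ` G"
      using hom_extends_to_simple_extension[OF R S D h' x(1)] MD by blast
    then have "G = M" using max by blast
    then show "x \<in> D" using G(3) MD by auto
  qed
qed

lemma algebraic_image:
  assumes h: "ring_hom_ring R S h" and R: "domain R" and K: "subfield K R" and S: "\<one>\<^bsub>S\<^esub> \<noteq> \<zero>\<^bsub>S\<^esub>"
    and x: "x \<in> carrier R" "((ring.algebraic R) over K) x"
  shows "((ring.algebraic S) over (h ` K)) (h x)"
proof -
  interpret R: domain R by fact
  interpret h: ring_hom_ring R S h by fact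
  obtain p where p: "p \<in> carrier (K[X]\<^bsub>R\<^esub>)" "p \<noteq> []" "R.eval p x = \<zero>\<^bsub>R\<^esub>"
    using R.algebraicE[OF subfieldE(1)[OF K] x] .
  have "h.S.eval (map h p) (h x) = \<zero>\<^bsub>S\<^esub>"
    using h.eval_hom[OF subfieldE(1)[OF K] x(1) p(1)] p(3) by simp
  then show ?thesis
    using h.S.algebraicI[OF h.subfield_polynomial_hom[OF K S p(1)]] p(2) by simp
qed

text \<open>A subring \<open>D\<close> above \<open>K\<close> contains \<open>K(x)\<close> for each of its elements \<open>x\<close>, and \<open>K(x)\<close> is a field if
\<open>x\<close> is algebraic; so \<open>D\<close> contains the inverse of \<open>x\<close>.\<close>
lemma (in domain) subring_of_algebraic_is_subfield:
  assumes K: "subfield K R" and D: "subring D R" "K \<subseteq> D"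
    and alg: "\<And>x. x \<in> D \<Longrightarrow> (algebraic over K) x"
  shows "subfield D R"
proof (rule subfieldI[OF subcringI'[OF D(1)]])
  show "Units (R\<lparr>carrier := D\<rparr>) = D - {\<zero>}"
  proof
    show "Units (R\<lparr>carrier := D\<rparr>) \<subseteq> D - {\<zero>}"
      using subringE(1)[OF D(1)] by (auto simp: Units_def)
    show "D - {\<zero>} \<subseteq> Units (R\<lparr>carrier := D\<rparr>)"
    proof
      fix x assume x: "x \<in> D - {\<zero>}"
      have xR: "x \<in> carrier R" using x subringE(1)[OF D(1)] by blast
      have "subfield (simple_extension K x) R"
        using simple_extension_is_subfield[OF K xR] alg x by blast
      moreover have "x \<in> simple_extension K x - {\<zero>}"
        using simple_extension_mem[OF subfieldE(1)[OF K] xR] x by blast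
      ultimately have "inv x \<in> simple_extension K x" "x \<otimes> inv x = \<one>" "inv x \<otimes> x = \<one>"
        using subfield_m_inv[of "simple_extension K x" x] by auto
      moreover have "simple_extension K x \<subseteq> D"
        using simple_extension_subring_incl[OF D] x by blast
      ultimately show "x \<in> Units (R\<lparr>carrier := D\<rparr>)"
        using x by (auto simp: Units_def)
    qed
  qed
qed

text \<open>Surjectivity comes from finiteness: \<open>h\<close> fixes the coefficients of a polynomial \<open>p\<close> over \<open>K\<close>, so it
maps the finite set of roots of \<open>p\<close> injectively into itself, hence onto itself.\<close>
lemma (in field) algebraic_endomorphism_is_automorphism:
  assumes K: "subfield K R" and alg: "\<And>x. x \<in> carrier R \<Longrightarrow> (algebraic over K) x"
    and h: "h \<in> ring_hom R R" and fixed: "\<And>x. x \<in> K \<Longrightarrow> h x = x"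
  shows "h \<in> ring_iso R R"
proof -
  interpret h: ring_hom_ring R R h using ring_axioms ring_axioms h by (rule ring_hom_ringI2)
  have inj: "inj_on h (carrier R)" using non_trivial_field_hom_is_inj[OF h field_axioms field_axioms] .
  have "y \<in> h ` carrier R" if y: "y \<in> carrier R" for y
  proof -
    obtain p where p: "p \<in> carrier (K[X])" "p \<noteq> []" "eval p y = \<zero>"
      using algebraicE[OF subfieldE(1)[OF K] y alg[OF y]] .
    let ?Z = "{x. is_root p x}"
    have "p \<in> carrier (poly_ring R)"
      using p(1) carrier_polynomial[OF subfieldE(1)[OF K]] by (simp add: univ_poly_carrier[symmetric])
    then have fin: "finite ?Z" by (rule finite_number_of_roots)
    have "set p \<subseteq> K" using p(1) polynomial_incl by (simp add: univ_poly_carrier[symmetric])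
    then have "map h p = p" using fixed by (auto intro!: map_idI)
    then have "eval p (h x) = h (eval p x)" if "x \<in> carrier R" for x
      using h.eval_hom[OF subfieldE(1)[OF K] that p(1)] by simp
    then have "h ` ?Z \<subseteq> ?Z" by (auto simp: is_root_def)
    moreover have "?Z \<subseteq> carrier R" by (auto simp: is_root_def)
    ultimately have "h ` ?Z = ?Z"
      using endo_inj_surj[OF fin] inj inj_on_subset by blast
    moreover have "y \<in> ?Z" using p y by (simp add: is_root_def)
    ultimately show ?thesis using \<open>?Z \<subseteq> carrier R\<close> by blast
  qed
  then have "bij_betw h (carrier R) (carrier R)"
    using inj h.hom_closed by (auto simp: bij_betw_def)
  then show ?thesis using h by (simp add: ring_iso_def)
qed

section \<open>Extension of isometric homomorphisms to limits\<close>

text \<open>Let \<open>G\<close> be the closure in \<open>T1 \<times> T2\<close> of the set of all pairs \<open>(a1 x, a2 x)\<close>; \<open>close p q\<close> says that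
\<open>(p, q)\<close> lies in \<open>G\<close>. As the ring operations are continuous, \<open>G\<close> is a subring of the product, and
as the two absolute values are continuous and agree on these pairs, they agree on \<open>G\<close>. So \<open>G\<close> is the
graph of an isometric homomorphism \<open>\<tau>\<close>, defined on the elements of \<open>T1\<close> whose partner exists in
\<open>T2\<close>. Which elements these are depends on the application.\<close>
theorem isometric_extension_to_closure:
  fixes A :: "('a, 'm) ring_scheme" and T1 :: "('b, 'n) ring_scheme" and T2 :: "('c, 'p) ring_scheme"
  assumes A: "ring A" and T1: "valued_domain T1 v1" and T2: "valued_domain T2 v2"
    and a1: "a1 \<in> ring_hom A T1" and a2: "a2 \<in> ring_hom A T2"
    and isom: "\<And>x. x \<in> carrier A \<Longrightarrow> v1 (a1 x) = v2 (a2 x)"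
  defines "close \<equiv> \<lambda>p q. \<forall>e>0. \<exists>x\<in>carrier A. v1 (p \<ominus>\<^bsub>T1\<^esub> a1 x) < e \<and> v2 (q \<ominus>\<^bsub>T2\<^esub> a2 x) < e"
  obtains D \<tau> where "subring D T1" "\<tau> \<in> ring_hom (T1\<lparr>carrier := D\<rparr>) T2"
    "\<And>x. x \<in> carrier A \<Longrightarrow> a1 x \<in> D \<and> \<tau> (a1 x) = a2 x"
    "\<And>p. p \<in> D \<Longrightarrow> v2 (\<tau> p) = v1 p"
    "\<And>p q. p \<in> carrier T1 \<Longrightarrow> q \<in> carrier T2 \<Longrightarrow> close p q \<Longrightarrow> p \<in> D \<and> \<tau> p = q"
proof -
  interpret A: ring A by fact
  interpret T1: valued_domain T1 v1 by fact
  interpret T2: valued_domain T2 v2 by fact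
  interpret a1: ring_hom_ring A T1 a1
    using A T1.ring_axioms a1 by (rule ring_hom_ringI2)
  interpret a2: ring_hom_ring A T2 a2
    using A T2.ring_axioms a2 by (rule ring_hom_ringI2)
  have closeE: "\<exists>x\<in>carrier A. v1 (p \<ominus>\<^bsub>T1\<^esub> a1 x) < e \<and> v2 (q \<ominus>\<^bsub>T2\<^esub> a2 x) < e"
    if "close p q" "e > 0" for p q e using that by (simp add: close_def)
  have image: "close (a1 x) (a2 x)" if x: "x \<in> carrier A" for x
    unfolding close_def
    using x T1.v_zero T2.v_zero a1.hom_closed[OF x] a2.hom_closed[OF x]
    by (auto intro!: bexI[of _ x] simp: T1.r_neg T2.r_neg a_minus_def)
  have norm: "v2 q = v1 p" if pq: "p \<in> carrier T1" "q \<in> carrier T2" "close p q" for p q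
  proof -
    have "\<bar>v2 q - v1 p\<bar> \<le> e" if "e > 0" for e
    proof -
      obtain x where x: "x \<in> carrier A" "v1 (p \<ominus>\<^bsub>T1\<^esub> a1 x) < e / 2" "v2 (q \<ominus>\<^bsub>T2\<^esub> a2 x) < e / 2"
        using closeE[OF pq(3), of "e / 2"] \<open>e > 0\<close> by auto
      then show ?thesis
        using T1.v_diff_le[OF pq(1) a1.hom_closed[OF x(1)]] T2.v_diff_le[OF pq(2) a2.hom_closed[OF x(1)]]
          isom[OF x(1)] by linarith
    qed
    then show ?thesis using zero_less_abs_iff dense not_less by (metis eq_iff_diff_eq_0)
  qed
  have neg: "close (\<ominus>\<^bsub>T1\<^esub> p) (\<ominus>\<^bsub>T2\<^esub> q)"
    if pq: "p \<in> carrier T1" "q \<in> carrier T2" "close p q" for p q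
    unfolding close_def
  proof (intro allI impI)
    fix e :: real assume "e > 0"
    then obtain x where x: "x \<in> carrier A" "v1 (p \<ominus>\<^bsub>T1\<^esub> a1 x) < e" "v2 (q \<ominus>\<^bsub>T2\<^esub> a2 x) < e"
      using closeE[OF pq(3)] by blast
    note c = pq(1,2) a1.hom_closed[OF x(1)] a2.hom_closed[OF x(1)]
    have "\<ominus>\<^bsub>T1\<^esub> p \<ominus>\<^bsub>T1\<^esub> a1 (\<ominus>\<^bsub>A\<^esub> x) = \<ominus>\<^bsub>T1\<^esub> (p \<ominus>\<^bsub>T1\<^esub> a1 x)"
      "\<ominus>\<^bsub>T2\<^esub> q \<ominus>\<^bsub>T2\<^esub> a2 (\<ominus>\<^bsub>A\<^esub> x) = \<ominus>\<^bsub>T2\<^esub> (q \<ominus>\<^bsub>T2\<^esub> a2 x)"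
      unfolding a1.hom_a_inv[OF x(1)] a2.hom_a_inv[OF x(1)] using c by (simp_all add: a_minus_def T1.minus_add T2.minus_add)
    then show "\<exists>x\<in>carrier A. v1 (\<ominus>\<^bsub>T1\<^esub> p \<ominus>\<^bsub>T1\<^esub> a1 x) < e \<and> v2 (\<ominus>\<^bsub>T2\<^esub> q \<ominus>\<^bsub>T2\<^esub> a2 x) < e"
      using x c T1.v_neg T2.v_neg by (intro bexI[of _ "\<ominus>\<^bsub>A\<^esub> x"]) auto
  qed
  have add: "close (p \<oplus>\<^bsub>T1\<^esub> p') (q \<oplus>\<^bsub>T2\<^esub> q')"
    if pq: "p \<in> carrier T1" "q \<in> carrier T2" "close p q" and pq': "p' \<in> carrier T1" "q' \<in> carrier T2" "close p' q'"
    for p q p' q'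
    unfolding close_def
  proof (intro allI impI)
    fix e :: real assume "e > 0"
    then obtain x y where x: "x \<in> carrier A" "v1 (p \<ominus>\<^bsub>T1\<^esub> a1 x) < e / 2" "v2 (q \<ominus>\<^bsub>T2\<^esub> a2 x) < e / 2"
      and y: "y \<in> carrier A" "v1 (p' \<ominus>\<^bsub>T1\<^esub> a1 y) < e / 2" "v2 (q' \<ominus>\<^bsub>T2\<^esub> a2 y) < e / 2"
      using closeE[OF pq(3), of "e / 2"] closeE[OF pq'(3), of "e / 2"] by auto
    note c1 = pq(1) pq'(1) a1.hom_closed[OF x(1)] a1.hom_closed[OF y(1)]
    note c2 = pq(2) pq'(2) a2.hom_closed[OF x(1)] a2.hom_closed[OF y(1)]
    have "(p \<oplus>\<^bsub>T1\<^esub> p') \<ominus>\<^bsub>T1\<^esub> (a1 x \<oplus>\<^bsub>T1\<^esub> a1 y) = (p \<ominus>\<^bsub>T1\<^esub> a1 x) \<oplus>\<^bsub>T1\<^esub> (p' \<ominus>\<^bsub>T1\<^esub> a1 y)"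
      using c1 by algebra
    then have 1: "v1 ((p \<oplus>\<^bsub>T1\<^esub> p') \<ominus>\<^bsub>T1\<^esub> a1 (x \<oplus>\<^bsub>A\<^esub> y)) < e"
      using T1.v_add[of "p \<ominus>\<^bsub>T1\<^esub> a1 x" "p' \<ominus>\<^bsub>T1\<^esub> a1 y"] x y c1 by simp
    have "(q \<oplus>\<^bsub>T2\<^esub> q') \<ominus>\<^bsub>T2\<^esub> (a2 x \<oplus>\<^bsub>T2\<^esub> a2 y) = (q \<ominus>\<^bsub>T2\<^esub> a2 x) \<oplus>\<^bsub>T2\<^esub> (q' \<ominus>\<^bsub>T2\<^esub> a2 y)"
      using c2 by algebra
    then have 2: "v2 ((q \<oplus>\<^bsub>T2\<^esub> q') \<ominus>\<^bsub>T2\<^esub> a2 (x \<oplus>\<^bsub>A\<^esub> y)) < e"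
      using T2.v_add[of "q \<ominus>\<^bsub>T2\<^esub> a2 x" "q' \<ominus>\<^bsub>T2\<^esub> a2 y"] x y c2 by simp
    show "\<exists>x\<in>carrier A. v1 ((p \<oplus>\<^bsub>T1\<^esub> p') \<ominus>\<^bsub>T1\<^esub> a1 x) < e \<and> v2 ((q \<oplus>\<^bsub>T2\<^esub> q') \<ominus>\<^bsub>T2\<^esub> a2 x) < e"
      using 1 2 A.a_closed[OF x(1) y(1)] by blast
  qed
  have mult: "close (p \<otimes>\<^bsub>T1\<^esub> p') (q \<otimes>\<^bsub>T2\<^esub> q')"
    if pq: "p \<in> carrier T1" "q \<in> carrier T2" "close p q" and pq': "p' \<in> carrier T1" "q' \<in> carrier T2" "close p' q'"
    for p q p' q'
    unfolding close_def
  proof (intro allI impI)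
    fix e :: real assume e: "e > 0"
    \<comment> \<open>The error of the product is at most \<open>d * v1 p' + (v1 p + 1) * d = d * B\<close>, where \<open>d \<le> 1\<close> keeps
      the absolute value of the approximation of \<open>p\<close> below \<open>v1 p + 1\<close>.\<close>
    define B where "B = 1 + v1 p + v1 p'"
    have v0: "v1 p \<ge> 0" "v1 p' \<ge> 0" using T1.v_nonneg pq pq' by auto
    then have B: "B \<ge> 1" by (simp add: B_def)
    define d where "d = min 1 (e / (2 * B))"
    have d: "d > 0" "d \<le> 1" "d * B \<le> e / 2"
      using e B by (auto simp: d_def min_def field_simps)
    have v2: "v2 q = v1 p" "v2 q' = v1 p'" using norm pq pq' by blast+
    obtain x where x: "x \<in> carrier A" "v1 (p \<ominus>\<^bsub>T1\<^esub> a1 x) < d" "v2 (q \<ominus>\<^bsub>T2\<^esub> a2 x) < d"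
      using closeE[OF pq(3) d(1)] by blast
    obtain y where y: "y \<in> carrier A" "v1 (p' \<ominus>\<^bsub>T1\<^esub> a1 y) < d" "v2 (q' \<ominus>\<^bsub>T2\<^esub> a2 y) < d"
      using closeE[OF pq'(3) d(1)] by blast
    have est: "v (s \<otimes>\<^bsub>T\<^esub> s' \<ominus>\<^bsub>T\<^esub> b \<otimes>\<^bsub>T\<^esub> b') < e"
      if T: "valued_domain T v" and c: "s \<in> carrier T" "s' \<in> carrier T" "b \<in> carrier T" "b' \<in> carrier T"
      and eq: "v s = v1 p" "v s' = v1 p'" and lt: "v (s \<ominus>\<^bsub>T\<^esub> b) < d" "v (s' \<ominus>\<^bsub>T\<^esub> b') < d"
      for T :: "('z, 'y) ring_scheme" and v s s' b b'
    proof -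
      interpret T: valued_domain T v by fact
      have "s \<otimes>\<^bsub>T\<^esub> s' \<ominus>\<^bsub>T\<^esub> b \<otimes>\<^bsub>T\<^esub> b' = (s \<ominus>\<^bsub>T\<^esub> b) \<otimes>\<^bsub>T\<^esub> s' \<oplus>\<^bsub>T\<^esub> b \<otimes>\<^bsub>T\<^esub> (s' \<ominus>\<^bsub>T\<^esub> b')"
        using c by algebra
      then have "v (s \<otimes>\<^bsub>T\<^esub> s' \<ominus>\<^bsub>T\<^esub> b \<otimes>\<^bsub>T\<^esub> b') \<le> v (s \<ominus>\<^bsub>T\<^esub> b) * v s' + v b * v (s' \<ominus>\<^bsub>T\<^esub> b')"
        using T.v_add[of "(s \<ominus>\<^bsub>T\<^esub> b) \<otimes>\<^bsub>T\<^esub> s'" "b \<otimes>\<^bsub>T\<^esub> (s' \<ominus>\<^bsub>T\<^esub> b')"]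
          T.v_mult[of "s \<ominus>\<^bsub>T\<^esub> b" s'] T.v_mult[of b "s' \<ominus>\<^bsub>T\<^esub> b'"] c by simp
      also have "\<dots> \<le> d * v s' + (v s + 1) * d"
      proof (intro add_mono mult_mono)
        show "v b \<le> v s + 1" using T.v_diff_le[OF c(1,3)] lt(1) d(2) by linarith
      qed (use lt T.v_nonneg c v0 eq d in auto)
      also have "\<dots> = d * B" by (simp add: eq B_def algebra_simps)
      also have "\<dots> < e" using d(3) e by simp
      finally show ?thesis .
    qed
    have "v1 (p \<otimes>\<^bsub>T1\<^esub> p' \<ominus>\<^bsub>T1\<^esub> a1 (x \<otimes>\<^bsub>A\<^esub> y)) < e"
      using est[OF T1 pq(1) pq'(1) a1.hom_closed[OF x(1)] a1.hom_closed[OF y(1)] refl refl x(2) y(2)]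
      by (simp only: a1.hom_mult[OF x(1) y(1)])
    moreover have "v2 (q \<otimes>\<^bsub>T2\<^esub> q' \<ominus>\<^bsub>T2\<^esub> a2 (x \<otimes>\<^bsub>A\<^esub> y)) < e"
      using est[OF T2 pq(2) pq'(2) a2.hom_closed[OF x(1)] a2.hom_closed[OF y(1)] v2 x(3) y(3)]
      by (simp only: a2.hom_mult[OF x(1) y(1)])
    ultimately show "\<exists>x\<in>carrier A. v1 (p \<otimes>\<^bsub>T1\<^esub> p' \<ominus>\<^bsub>T1\<^esub> a1 x) < e \<and> v2 (q \<otimes>\<^bsub>T2\<^esub> q' \<ominus>\<^bsub>T2\<^esub> a2 x) < e"
      using A.m_closed[OF x(1) y(1)] by blast
  qed
  define D where "D = {p \<in> carrier T1. \<exists>q\<in>carrier T2. close p q}"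
  define \<tau> where "\<tau> p = (SOME q. q \<in> carrier T2 \<and> close p q)" for p
  have \<tau>: "p \<in> carrier T1" "\<tau> p \<in> carrier T2" "close p (\<tau> p)" if p: "p \<in> D" for p
  proof -
    have "\<exists>q. q \<in> carrier T2 \<and> close p q" using p by (auto simp: D_def)
    then have "\<tau> p \<in> carrier T2 \<and> close p (\<tau> p)" unfolding \<tau>_def by (rule someI_ex)
    then show "p \<in> carrier T1" "\<tau> p \<in> carrier T2" "close p (\<tau> p)" using p by (auto simp: D_def)
  qed
  have D_I: "p \<in> D \<and> \<tau> p = q" if pq: "p \<in> carrier T1" "q \<in> carrier T2" "close p q" for p q
  proof -
    have p: "p \<in> D" using pq by (auto simp: D_def)
    note t = \<tau>[OF p]
    have "close (p \<oplus>\<^bsub>T1\<^esub> (\<ominus>\<^bsub>T1\<^esub> p)) (\<tau> p \<oplus>\<^bsub>T2\<^esub> (\<ominus>\<^bsub>T2\<^esub> q))"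
      using add[OF t] neg[OF pq] pq by simp
    then have "v2 (\<tau> p \<ominus>\<^bsub>T2\<^esub> q) = 0"
      using norm[of "p \<oplus>\<^bsub>T1\<^esub> (\<ominus>\<^bsub>T1\<^esub> p)" "\<tau> p \<oplus>\<^bsub>T2\<^esub> (\<ominus>\<^bsub>T2\<^esub> q)"] pq t T1.v_zero
      by (simp add: T1.r_neg a_minus_def)
    then have "\<tau> p = q"
      using T2.v_eq_0_iff[of "\<tau> p \<ominus>\<^bsub>T2\<^esub> q"] t pq by (simp add: T2.r_right_minus_eq)
    with p show ?thesis by blast
  qed
  have "subring D T1"
  proof (rule T1.subringI)
    show "D \<subseteq> carrier T1" by (auto simp: D_def)
    show "\<one>\<^bsub>T1\<^esub> \<in> D" using D_I[OF T1.one_closed T2.one_closed] image[OF A.one_closed] by simp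
    show "\<ominus>\<^bsub>T1\<^esub> p \<in> D" if p: "p \<in> D" for p
      using D_I[OF _ _ neg[OF \<tau>[OF p]]] \<tau>[OF p] by simp
    show "p \<otimes>\<^bsub>T1\<^esub> p' \<in> D" if p: "p \<in> D" "p' \<in> D" for p p'
      using D_I[OF _ _ mult[OF \<tau>[OF p(1)] \<tau>[OF p(2)]]] \<tau>[OF p(1)] \<tau>[OF p(2)] by simp
    show "p \<oplus>\<^bsub>T1\<^esub> p' \<in> D" if p: "p \<in> D" "p' \<in> D" for p p'
      using D_I[OF _ _ add[OF \<tau>[OF p(1)] \<tau>[OF p(2)]]] \<tau>[OF p(1)] \<tau>[OF p(2)] by simp
  qed
  moreover have "\<tau> \<in> ring_hom (T1\<lparr>carrier := D\<rparr>) T2"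
  proof (rule ring_hom_memI)
    show "\<tau> p \<in> carrier T2" if "p \<in> carrier (T1\<lparr>carrier := D\<rparr>)" for p using \<tau>(2)[of p] that by simp
    fix p p' assume "p \<in> carrier (T1\<lparr>carrier := D\<rparr>)" "p' \<in> carrier (T1\<lparr>carrier := D\<rparr>)"
    then have p: "p \<in> D" "p' \<in> D" by simp_all
    show "\<tau> (p \<otimes>\<^bsub>T1\<lparr>carrier := D\<rparr>\<^esub> p') = \<tau> p \<otimes>\<^bsub>T2\<^esub> \<tau> p'"
      using D_I[OF _ _ mult[OF \<tau>[OF p(1)] \<tau>[OF p(2)]]] \<tau>[OF p(1)] \<tau>[OF p(2)] by simp
    show "\<tau> (p \<oplus>\<^bsub>T1\<lparr>carrier := D\<rparr>\<^esub> p') = \<tau> p \<oplus>\<^bsub>T2\<^esub> \<tau> p'"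
      using D_I[OF _ _ add[OF \<tau>[OF p(1)] \<tau>[OF p(2)]]] \<tau>[OF p(1)] \<tau>[OF p(2)] by simp
  next
    show "\<tau> \<one>\<^bsub>T1\<lparr>carrier := D\<rparr>\<^esub> = \<one>\<^bsub>T2\<^esub>" using D_I[OF T1.one_closed T2.one_closed] image[OF A.one_closed] by simp
  qed
  moreover have "a1 x \<in> D \<and> \<tau> (a1 x) = a2 x" if x: "x \<in> carrier A" for x
    using D_I[OF a1.hom_closed[OF x] a2.hom_closed[OF x] image[OF x]] .
  moreover have "v2 (\<tau> p) = v1 p" if "p \<in> D" for p using norm \<tau>[OF that] by blast
  ultimately show thesis using that D_I by blast
qed

section \<open>Cauchy sequences modulo null sequences\<close>

definition cauchy_seq_ring :: "('a, 'm) ring_scheme \<Rightarrow> ('a \<Rightarrow> real) \<Rightarrow> (nat \<Rightarrow> 'a) ring" where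
  "cauchy_seq_ring R v =
     \<lparr>carrier = {s. cauchy_in R (carrier R) v s},
      monoid.mult = \<lambda>s t n. s n \<otimes>\<^bsub>R\<^esub> t n, one = \<lambda>_. \<one>\<^bsub>R\<^esub>,
      zero = \<lambda>_. \<zero>\<^bsub>R\<^esub>, add = \<lambda>s t n. s n \<oplus>\<^bsub>R\<^esub> t n\<rparr>"

definition null_seqs :: "('a, 'm) ring_scheme \<Rightarrow> ('a \<Rightarrow> real) \<Rightarrow> (nat \<Rightarrow> 'a) set" where
  "null_seqs R v = {s \<in> carrier (cauchy_seq_ring R v). (\<lambda>n. v (s n)) \<longlonglongrightarrow> 0}"

lemma cauchy_seq_ring_simps [simp]:
  "s \<in> carrier (cauchy_seq_ring R v) \<longleftrightarrow> cauchy_in R (carrier R) v s"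
  "s \<otimes>\<^bsub>cauchy_seq_ring R v\<^esub> t = (\<lambda>n. s n \<otimes>\<^bsub>R\<^esub> t n)"
  "\<one>\<^bsub>cauchy_seq_ring R v\<^esub> = (\<lambda>_. \<one>\<^bsub>R\<^esub>)"
  "\<zero>\<^bsub>cauchy_seq_ring R v\<^esub> = (\<lambda>_. \<zero>\<^bsub>R\<^esub>)"
  "s \<oplus>\<^bsub>cauchy_seq_ring R v\<^esub> t = (\<lambda>n. s n \<oplus>\<^bsub>R\<^esub> t n)"
  by (simp_all add: cauchy_seq_ring_def)

context valued_domain
begin

abbreviation S where "S \<equiv> cauchy_seq_ring R v"
abbreviation I where "I \<equiv> null_seqs R v"

lemma cauchy_carrier: "cauchy_in R (carrier R) v s \<Longrightarrow> s n \<in> carrier R"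
  by (simp add: cauchy_in_def)

lemma cauchyD:
  "cauchy_in R (carrier R) v s \<Longrightarrow> e > 0 \<Longrightarrow> \<exists>N. \<forall>m\<ge>N. \<forall>n\<ge>N. v (s m \<ominus> s n) < e"
  by (simp add: cauchy_in_def)

lemma cauchy_const: "x \<in> carrier R \<Longrightarrow> cauchy_in R (carrier R) v (\<lambda>_. x)"
  by (simp add: cauchy_in_def a_minus_def r_neg v_zero)

lemma cauchy_neg:
  assumes s: "cauchy_in R (carrier R) v s"
  shows "cauchy_in R (carrier R) v (\<lambda>n. \<ominus> s n)"
proof -
  note c = cauchy_carrier[OF s]
  have "v (\<ominus> s m \<ominus> (\<ominus> s n)) = v (s m \<ominus> s n)" for m n
  proof -
    have "\<ominus> s m \<ominus> (\<ominus> s n) = \<ominus> (s m \<ominus> s n)"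
      using c[of m] c[of n] by (simp add: a_minus_def minus_add)
    then show ?thesis using c v_neg by simp
  qed
  then show ?thesis using s c by (simp add: cauchy_in_def)
qed

lemma cauchy_add:
  assumes s: "cauchy_in R (carrier R) v s" and t: "cauchy_in R (carrier R) v t"
  shows "cauchy_in R (carrier R) v (\<lambda>n. s n \<oplus> t n)"
  unfolding cauchy_in_def
proof (intro conjI allI impI)
  note c = cauchy_carrier[OF s] cauchy_carrier[OF t]
  show "s n \<oplus> t n \<in> carrier R" for n using c by simp
  fix e :: real assume "e > 0"
  then have "e / 2 > 0" by simp
  then obtain N1 N2 where N1: "\<And>m n. m \<ge> N1 \<Longrightarrow> n \<ge> N1 \<Longrightarrow> v (s m \<ominus> s n) < e / 2"
    and N2: "\<And>m n. m \<ge> N2 \<Longrightarrow> n \<ge> N2 \<Longrightarrow> v (t m \<ominus> t n) < e / 2"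
    using cauchyD[OF s, of "e / 2"] cauchyD[OF t, of "e / 2"] by blast
  have "v ((s m \<oplus> t m) \<ominus> (s n \<oplus> t n)) < e" if mn: "m \<ge> max N1 N2" "n \<ge> max N1 N2" for m n
  proof -
    have "(s m \<oplus> t m) \<ominus> (s n \<oplus> t n) = (s m \<ominus> s n) \<oplus> (t m \<ominus> t n)"
      using c(1)[of m] c(1)[of n] c(2)[of m] c(2)[of n] by algebra
    then show ?thesis
      using v_add[of "s m \<ominus> s n" "t m \<ominus> t n"] N1[of m n] N2[of m n] mn c by simp
  qed
  then show "\<exists>N. \<forall>m\<ge>N. \<forall>n\<ge>N. v ((s m \<oplus> t m) \<ominus> (s n \<oplus> t n)) < e" by blast
qed

lemma cauchy_v_convergent:
  assumes s: "cauchy_in R (carrier R) v s"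
  shows "convergent (\<lambda>n. v (s n))"
proof (rule Cauchy_convergent, rule metric_CauchyI)
  fix e :: real assume "e > 0"
  then obtain N where N: "\<And>m n. m \<ge> N \<Longrightarrow> n \<ge> N \<Longrightarrow> v (s m \<ominus> s n) < e"
    using cauchyD[OF s] by blast
  have "dist (v (s m)) (v (s n)) < e" if "m \<ge> N" "n \<ge> N" for m n
    using v_diff_le[OF cauchy_carrier[OF s, of m] cauchy_carrier[OF s, of n]] N[OF that]
    by (simp add: dist_real_def)
  then show "\<exists>M. \<forall>m\<ge>M. \<forall>n\<ge>M. dist (v (s m)) (v (s n)) < e" by blast
qed

lemma cauchy_bounded:
  assumes s: "cauchy_in R (carrier R) v s"
  obtains B where "B > 0" "\<And>n. v (s n) \<le> B"
proof -
  have "Bseq (\<lambda>n. v (s n))" using convergent_imp_Bseq[OF cauchy_v_convergent[OF s]] .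
  then obtain B where B: "B > 0" "\<And>n. norm (v (s n)) \<le> B" by (auto elim: BseqE)
  have "v (s n) \<le> B" for n using B(2)[of n] by simp
  then show thesis using that[OF B(1)] by blast
qed

lemma cauchy_mult:
  assumes s: "cauchy_in R (carrier R) v s" and t: "cauchy_in R (carrier R) v t"
  shows "cauchy_in R (carrier R) v (\<lambda>n. s n \<otimes> t n)"
  unfolding cauchy_in_def
proof (intro conjI allI impI)
  note c = cauchy_carrier[OF s] cauchy_carrier[OF t]
  show "s n \<otimes> t n \<in> carrier R" for n using c by simp
  fix e :: real assume e: "e > 0"
  obtain B B' where B: "B > 0" "\<And>n. v (s n) \<le> B" and B': "B' > 0" "\<And>n. v (t n) \<le> B'"
    using cauchy_bounded[OF s] cauchy_bounded[OF t] by metis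
  have "e / (2 * B') > 0" "e / (2 * B) > 0" using e B B' by simp_all
  then obtain N1 N2 where N1: "\<And>m n. m \<ge> N1 \<Longrightarrow> n \<ge> N1 \<Longrightarrow> v (s m \<ominus> s n) < e / (2 * B')"
    and N2: "\<And>m n. m \<ge> N2 \<Longrightarrow> n \<ge> N2 \<Longrightarrow> v (t m \<ominus> t n) < e / (2 * B)"
    using cauchyD[OF s, of "e / (2 * B')"] cauchyD[OF t, of "e / (2 * B)"] by blast
  have "v (s m \<otimes> t m \<ominus> s n \<otimes> t n) < e" if mn: "m \<ge> max N1 N2" "n \<ge> max N1 N2" for m n
  proof -
    note cc = c(1)[of m] c(1)[of n] c(2)[of m] c(2)[of n]
    have "s m \<otimes> t m \<ominus> s n \<otimes> t n = (s m \<ominus> s n) \<otimes> t m \<oplus> s n \<otimes> (t m \<ominus> t n)"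
      using cc by algebra
    then have "v (s m \<otimes> t m \<ominus> s n \<otimes> t n) \<le> v (s m \<ominus> s n) * v (t m) + v (s n) * v (t m \<ominus> t n)"
      using v_add[of "(s m \<ominus> s n) \<otimes> t m" "s n \<otimes> (t m \<ominus> t n)"]
        v_mult[of "s m \<ominus> s n" "t m"] v_mult[of "s n" "t m \<ominus> t n"] cc by simp
    also have "\<dots> \<le> v (s m \<ominus> s n) * B' + B * v (t m \<ominus> t n)"
      using B B' v_nonneg cc by (intro add_mono mult_left_mono mult_right_mono) auto
    also have "\<dots> < e / (2 * B') * B' + B * (e / (2 * B))"
      using N1[of m n] N2[of m n] mn B(1) B'(1)
      by (intro add_strict_mono mult_strict_right_mono mult_strict_left_mono) auto
    also have "\<dots> = e" using B(1) B'(1) by (simp add: field_simps)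
    finally show ?thesis .
  qed
  then show "\<exists>N. \<forall>m\<ge>N. \<forall>n\<ge>N. v (s m \<otimes> t m \<ominus> s n \<otimes> t n) < e" by blast
qed

lemma cauchy_seq_cring: "cring S"
proof (rule cringI)
  show "abelian_group S"
  proof (rule abelian_groupI)
    fix s assume s: "s \<in> carrier S"
    then have "(\<lambda>n. \<ominus> s n) \<in> carrier S" "(\<lambda>n. \<ominus> s n) \<oplus>\<^bsub>S\<^esub> s = \<zero>\<^bsub>S\<^esub>"
      using cauchy_neg cauchy_carrier by (auto simp: l_neg)
    then show "\<exists>t\<in>carrier S. t \<oplus>\<^bsub>S\<^esub> s = \<zero>\<^bsub>S\<^esub>" by blast
  qed (auto simp: cauchy_add cauchy_const cauchy_carrier a_assoc a_comm a_lcomm)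
  show "comm_monoid S"
    by (rule comm_monoidI)
      (auto simp: cauchy_mult cauchy_const cauchy_carrier m_assoc m_comm m_lcomm)
qed (auto simp: cauchy_carrier l_distr)

lemma cauchy_seq_neg:
  assumes s: "cauchy_in R (carrier R) v s"
  shows "\<ominus>\<^bsub>S\<^esub> s = (\<lambda>n. \<ominus> s n)"
proof -
  interpret S: cring S by (rule cauchy_seq_cring)
  show ?thesis
    using s cauchy_neg[OF s] cauchy_carrier[OF s]
    by (intro S.minus_equality) (auto simp: l_neg)
qed

lemma cauchy_seq_minus:
  assumes "cauchy_in R (carrier R) v s" "cauchy_in R (carrier R) v t"
  shows "s \<ominus>\<^bsub>S\<^esub> t = (\<lambda>n. s n \<ominus> t n)"
  using cauchy_seq_neg[OF assms(2)] by (simp add: a_minus_def)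

definition seq_abs :: "(nat \<Rightarrow> 'a) \<Rightarrow> real" where
  "seq_abs s = lim (\<lambda>n. v (s n))"

lemma seq_abs_LIMSEQ:
  "cauchy_in R (carrier R) v s \<Longrightarrow> (\<lambda>n. v (s n)) \<longlonglongrightarrow> seq_abs s"
  unfolding seq_abs_def using cauchy_v_convergent convergent_LIMSEQ_iff by blast

lemma seq_abs_nonneg: "cauchy_in R (carrier R) v s \<Longrightarrow> 0 \<le> seq_abs s"
  using LIMSEQ_le_const[OF seq_abs_LIMSEQ, of s 0] v_nonneg cauchy_carrier by blast

lemma null_seqs_iff: "s \<in> I \<longleftrightarrow> cauchy_in R (carrier R) v s \<and> seq_abs s = 0"
  unfolding null_seqs_def using seq_abs_LIMSEQ LIMSEQ_unique by fastforce

lemma seq_abs_const: "x \<in> carrier R \<Longrightarrow> seq_abs (\<lambda>_. x) = v x"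
  by (simp add: seq_abs_def)

lemma seq_abs_mult:
  assumes s: "cauchy_in R (carrier R) v s" and t: "cauchy_in R (carrier R) v t"
  shows "seq_abs (\<lambda>n. s n \<otimes> t n) = seq_abs s * seq_abs t"
proof -
  have "(\<lambda>n. v (s n \<otimes> t n)) \<longlonglongrightarrow> seq_abs s * seq_abs t"
    using tendsto_mult[OF seq_abs_LIMSEQ[OF s] seq_abs_LIMSEQ[OF t]] v_mult cauchy_carrier s t by simp
  then show ?thesis using seq_abs_LIMSEQ[OF cauchy_mult[OF s t]] LIMSEQ_unique by blast
qed

lemma seq_abs_add:
  assumes s: "cauchy_in R (carrier R) v s" and t: "cauchy_in R (carrier R) v t"
  shows "seq_abs (\<lambda>n. s n \<oplus> t n) \<le> seq_abs s + seq_abs t"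
  using LIMSEQ_le[OF seq_abs_LIMSEQ[OF cauchy_add[OF s t]]
      tendsto_add[OF seq_abs_LIMSEQ[OF s] seq_abs_LIMSEQ[OF t]]]
    v_add cauchy_carrier s t by blast

lemma seq_abs_neg:
  assumes s: "cauchy_in R (carrier R) v s"
  shows "seq_abs (\<lambda>n. \<ominus> s n) = seq_abs s"
  using v_neg cauchy_carrier[OF s] by (simp add: seq_abs_def)

text \<open>The limit of \<open>v (s n)\<close> is a multiplicative seminorm on the ring of Cauchy sequences, with kernel
the null sequences. A product of limits vanishes only if one of them does, so the kernel is prime.\<close>
lemma null_seqs_prime: "primeideal I S"
proof -
  interpret S: cring S by (rule cauchy_seq_cring)
  have sub: "subgroup I (add_monoid S)"
  proof (rule S.add.subgroupI)
    show "I \<subseteq> carrier S" by (auto simp: null_seqs_iff)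
    have "(\<lambda>_. \<zero>) \<in> I" using cauchy_const seq_abs_const v_zero by (simp add: null_seqs_iff)
    then show "I \<noteq> {}" by blast
    show "\<ominus>\<^bsub>S\<^esub> s \<in> I" if "s \<in> I" for s
      using that cauchy_seq_neg[of s] cauchy_neg[of s] seq_abs_neg[of s] by (simp add: null_seqs_iff)
    show "s \<oplus>\<^bsub>S\<^esub> t \<in> I" if "s \<in> I" "t \<in> I" for s t
      using that cauchy_add[of s t] seq_abs_add[of s t] seq_abs_nonneg[of "\<lambda>n. s n \<oplus> t n"]
      by (simp add: null_seqs_iff)
  qed
  have absorb: "t \<otimes>\<^bsub>S\<^esub> s \<in> I" "s \<otimes>\<^bsub>S\<^esub> t \<in> I" if "s \<in> I" "t \<in> carrier S" for s t
    using that cauchy_mult[of t s] cauchy_mult[of s t] seq_abs_mult[of t s] seq_abs_mult[of s t]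
    by (simp_all add: null_seqs_iff)
  have idl: "ideal I S"
    by (rule idealI[OF S.ring_axioms sub absorb])
  show ?thesis
  proof (rule primeidealI[OF idl S.is_cring])
    have "(\<lambda>_. \<one>) \<notin> I" using seq_abs_const v_one by (simp add: null_seqs_iff)
    moreover have "(\<lambda>_. \<one>) \<in> carrier S" using cauchy_const[OF one_closed] by simp
    ultimately show "carrier S \<noteq> I" by metis
    show "s \<in> I \<or> t \<in> I" if "s \<in> carrier S" "t \<in> carrier S" "s \<otimes>\<^bsub>S\<^esub> t \<in> I" for s t
      using that seq_abs_mult[of s t] by (simp add: null_seqs_iff)
  qed
qed

text \<open>This is the usual construction of the completion, stopped as soon as it gives what is needed: an
integral domain with an absolute value in which the Cauchy sequences of \<open>R\<close> have limits.
A Cauchy sequence \<open>s\<close> converges to its own class, because the distance of \<open>\<iota> (s n)\<close> from this class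
is the limit over \<open>m\<close> of \<open>v (s n \<ominus> s m)\<close>.\<close>
theorem exists_domain_of_Cauchy_limits:
  obtains C :: "(nat \<Rightarrow> 'a) set ring" and w \<iota> where
    "valued_domain C w" "\<iota> \<in> ring_hom R C" "\<And>x. x \<in> carrier R \<Longrightarrow> w (\<iota> x) = v x"
    "\<And>s. cauchy_in R (carrier R) v s \<Longrightarrow> \<exists>l\<in>carrier C. (\<lambda>n. w (\<iota> (s n) \<ominus>\<^bsub>C\<^esub> l)) \<longlonglongrightarrow> 0"
proof -
  interpret S: cring S by (rule cauchy_seq_cring)
  interpret I: primeideal I S by (rule null_seqs_prime)
  let ?C = "S Quot I"
  let ?q = "\<lambda>s. I +>\<^bsub>S\<^esub> s"
  interpret C: domain ?C by (rule I.quotient_is_domain)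
  interpret q: ring_hom_ring S ?C ?q by (rule I.rcos_ring_hom_ring)
  \<comment> \<open>The seminorm is constant on cosets of the null sequences, so any representative will do.\<close>
  define w where "w Z = seq_abs (SOME s. s \<in> carrier S \<and> ?q s = Z)" for Z
  have surj: "\<exists>s\<in>carrier S. ?q s = Z" if "Z \<in> carrier ?C" for Z
    using that by (auto simp: FactRing_def A_RCOSETS_def')
  have w: "w (?q s) = seq_abs s" if s: "s \<in> carrier S" for s
  proof -
    define t where "t = (SOME t. t \<in> carrier S \<and> ?q t = ?q s)"
    have t: "t \<in> carrier S" "?q t = ?q s"
      using someI[of "\<lambda>t. t \<in> carrier S \<and> ?q t = ?q s" s] s unfolding t_def by blast+
    have le: "seq_abs x \<le> seq_abs y" if xy: "x \<in> carrier S" "y \<in> carrier S" "?q x = ?q y" for x y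
    proof -
      have d: "x \<ominus>\<^bsub>S\<^esub> y \<in> I"
        using S.quotient_eq_iff_same_a_r_cos[OF I.is_ideal xy(1,2)] xy(3) by simp
      have "x = (\<lambda>n. (x \<ominus>\<^bsub>S\<^esub> y) n \<oplus> y n)"
        using xy(1,2) cauchy_seq_minus[of x y] cauchy_carrier
        by (auto simp: a_minus_def a_assoc l_neg)
      then show ?thesis
        using seq_abs_add[of "x \<ominus>\<^bsub>S\<^esub> y" y] d xy(2) by (simp add: null_seqs_iff)
    qed
    have "w (?q s) = seq_abs t" by (simp add: w_def t_def)
    also have "\<dots> = seq_abs s" using le[OF t(1) s t(2)] le[OF s t(1)] t(2) by simp
    finally show ?thesis .
  qed
  have "absolute_value ?C w"
    unfolding absolute_value_def
  proof (intro conjI ballI)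
    fix Z assume "Z \<in> carrier ?C"
    then obtain s where s: "s \<in> carrier S" "Z = ?q s" using surj by blast
    show "0 \<le> w Z" using w[OF s(1)] s seq_abs_nonneg by simp
    have "s \<ominus>\<^bsub>S\<^esub> \<zero>\<^bsub>S\<^esub> = s" using s(1) S.minus_zero S.r_zero unfolding a_minus_def by presburger
    then have "s \<in> I \<longleftrightarrow> ?q s = ?q \<zero>\<^bsub>S\<^esub>"
      using S.quotient_eq_iff_same_a_r_cos[OF I.is_ideal s(1) S.zero_closed] by simp
    then show "w Z = 0 \<longleftrightarrow> Z = \<zero>\<^bsub>?C\<^esub>"
      using w[OF s(1)] s q.hom_zero by (simp add: null_seqs_iff)
    fix W assume "W \<in> carrier ?C"
    then obtain t where t: "t \<in> carrier S" "W = ?q t" using surj by blast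
    have "w (Z \<otimes>\<^bsub>?C\<^esub> W) = seq_abs (s \<otimes>\<^bsub>S\<^esub> t)"
      unfolding s(2) t(2) q.hom_mult[OF s(1) t(1), symmetric] by (rule w[OF S.m_closed[OF s(1) t(1)]])
    then show "w (Z \<otimes>\<^bsub>?C\<^esub> W) = w Z * w W"
      using seq_abs_mult[of s t] s t w by simp
    have "w (Z \<oplus>\<^bsub>?C\<^esub> W) = seq_abs (s \<oplus>\<^bsub>S\<^esub> t)"
      unfolding s(2) t(2) q.hom_add[OF s(1) t(1), symmetric] by (rule w[OF S.a_closed[OF s(1) t(1)]])
    then show "w (Z \<oplus>\<^bsub>?C\<^esub> W) \<le> w Z + w W"
      using seq_abs_add[of s t] s t w by simp
  qed
  then have C: "valued_domain ?C w"
    by (simp add: valued_domain_def valued_domain_axioms_def C.domain_axioms)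
  define \<iota> where "\<iota> x = ?q (\<lambda>_. x)" for x
  have const: "(\<lambda>_. x) \<in> carrier S" if "x \<in> carrier R" for x using cauchy_const[OF that] by simp
  have hom: "\<iota> \<in> ring_hom R ?C"
  proof (rule ring_hom_memI)
    fix x y assume xy: "x \<in> carrier R" "y \<in> carrier R"
    show "\<iota> x \<in> carrier ?C" unfolding \<iota>_def by (rule q.hom_closed[OF const[OF xy(1)]])
    show "\<iota> (x \<otimes> y) = \<iota> x \<otimes>\<^bsub>?C\<^esub> \<iota> y"
      unfolding \<iota>_def q.hom_mult[OF const[OF xy(1)] const[OF xy(2)], symmetric] by simp
    show "\<iota> (x \<oplus> y) = \<iota> x \<oplus>\<^bsub>?C\<^esub> \<iota> y"
      unfolding \<iota>_def q.hom_add[OF const[OF xy(1)] const[OF xy(2)], symmetric] by simp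
  next
    show "\<iota> \<one> = \<one>\<^bsub>?C\<^esub>" using q.hom_one by (simp add: \<iota>_def)
  qed
  have isom: "w (\<iota> x) = v x" if "x \<in> carrier R" for x
    using w[OF const[OF that]] seq_abs_const[OF that] by (simp add: \<iota>_def)
  have lim: "\<exists>l\<in>carrier ?C. (\<lambda>n. w (\<iota> (s n) \<ominus>\<^bsub>?C\<^esub> l)) \<longlonglongrightarrow> 0"
    if s: "cauchy_in R (carrier R) v s" for s
  proof (rule bexI)
    have sS: "s \<in> carrier S" using s by simp
    show "?q s \<in> carrier ?C" by (rule q.hom_closed[OF sS])
    have d: "cauchy_in R (carrier R) v (\<lambda>m. s n \<ominus> s m)" for n
      using cauchy_seq_minus[OF cauchy_const[OF cauchy_carrier[OF s]] s, of n]
        S.minus_closed[OF const[OF cauchy_carrier[OF s]] sS, of n] by simp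
    have eq: "w (\<iota> (s n) \<ominus>\<^bsub>?C\<^esub> ?q s) = seq_abs (\<lambda>m. s n \<ominus> s m)" for n
    proof -
      have "\<iota> (s n) \<ominus>\<^bsub>?C\<^esub> ?q s = ?q (\<lambda>m. s n \<ominus> s m)"
        unfolding \<iota>_def q.hom_minus[OF const[OF cauchy_carrier[OF s]] sS, symmetric]
        using cauchy_seq_minus[OF cauchy_const[OF cauchy_carrier[OF s]] s, of n] by simp
      then show ?thesis using w[of "\<lambda>m. s n \<ominus> s m"] d by simp
    qed
    show "(\<lambda>n. w (\<iota> (s n) \<ominus>\<^bsub>?C\<^esub> ?q s)) \<longlonglongrightarrow> 0"
    proof (rule LIMSEQ_I)
      fix e :: real assume "e > 0"
      then have "e / 2 > 0" by simp
      then obtain N where N: "\<And>m n. m \<ge> N \<Longrightarrow> n \<ge> N \<Longrightarrow> v (s m \<ominus> s n) < e / 2"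
        using cauchyD[OF s, of "e / 2"] by blast
      have "seq_abs (\<lambda>m. s n \<ominus> s m) \<le> e / 2" if n: "n \<ge> N" for n
        using LIMSEQ_le_const2[OF seq_abs_LIMSEQ[OF d, of n], of "e / 2"] N[OF n] less_imp_le by blast
      then have "norm (w (\<iota> (s n) \<ominus>\<^bsub>?C\<^esub> ?q s) - 0) < e" if n: "n \<ge> N" for n
        using n eq[of n] seq_abs_nonneg[OF d, of n] \<open>e > 0\<close> by fastforce
      then show "\<exists>N. \<forall>n\<ge>N. norm (w (\<iota> (s n) \<ominus>\<^bsub>?C\<^esub> ?q s) - 0) < e" by blast
    qed
  qed
  show thesis using that[OF C hom isom lim] .
qed

end

section \<open>Dense images of finite extensions\<close>

lemma (in valued_domain) cauchy_if_convergent: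
  assumes s: "\<And>n. s n \<in> A" and A: "A \<subseteq> carrier R" and y: "y \<in> carrier R"
    and lim: "(\<lambda>n. v (y \<ominus> s n)) \<longlonglongrightarrow> 0"
  shows "cauchy_in R A v s"
  unfolding cauchy_in_def
proof (intro conjI allI impI)
  fix e :: real assume "e > 0"
  then obtain N where N: "\<And>n. n \<ge> N \<Longrightarrow> v (y \<ominus> s n) < e / 2"
    using order_tendstoD(2)[OF lim, of "e / 2"] by (auto simp: eventually_sequentially)
  have sR: "s n \<in> carrier R" for n using s A by blast
  have "v (s m \<ominus> s n) < e" if "m \<ge> N" "n \<ge> N" for m n
    using v_triangle[OF sR y sR, of m n] v_minus_commute[OF sR y, of m] N[OF that(1)] N[OF that(2)]
    by simp
  then show "\<exists>N. \<forall>m\<ge>N. \<forall>n\<ge>N. v (s m \<ominus> s n) < e" by blast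
qed (rule s)

lemma null_sequence_of_approximations:
  fixes d :: "'a \<Rightarrow> real"
  assumes "\<And>e. 0 < e \<Longrightarrow> \<exists>x\<in>A. d x < e" and "\<And>x. x \<in> A \<Longrightarrow> 0 \<le> d x"
  obtains s :: "nat \<Rightarrow> 'a" where "\<And>n. s n \<in> A" "(\<lambda>n. d (s n)) \<longlonglongrightarrow> 0"
proof -
  have "\<exists>x\<in>A. d x < 1 / real (Suc n)" for n using assms(1) by simp
  then obtain s where s: "\<And>n. s n \<in> A" "\<And>n. d (s n) < 1 / real (Suc n)" by metis
  have "(\<lambda>n. d (s n)) \<longlonglongrightarrow> 0"
    using assms(2)[OF s(1)] less_imp_le[OF s(2)] lim_1_over_n[THEN LIMSEQ_Suc] by (rule tendsto_0_squeeze)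
  with s(1) show thesis using that by blast
qed

lemma (in valued_domain) complete_dense_eq:
  assumes W: "W \<subseteq> carrier R" "complete_in R W v"
    and dense: "\<And>y e. y \<in> carrier R \<Longrightarrow> 0 < e \<Longrightarrow> \<exists>x\<in>W. v (y \<ominus> x) < e"
  shows "W = carrier R"
proof
  show "carrier R \<subseteq> W"
  proof
    fix y assume y: "y \<in> carrier R"
    obtain s where s: "\<And>n. s n \<in> W" "(\<lambda>n. v (y \<ominus> s n)) \<longlonglongrightarrow> 0"
      using null_sequence_of_approximations[of W "\<lambda>x. v (y \<ominus> x)"] dense[OF y] v_nonneg y W(1) by blast
    obtain l where l: "l \<in> W" "(\<lambda>n. v (s n \<ominus> l)) \<longlonglongrightarrow> 0"
      using cauchy_if_convergent[OF s(1) W(1) y s(2)] W(2) by (auto simp: complete_in_def)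
    have lR: "l \<in> carrier R" using l W by blast
    have "v (y \<ominus> l) \<le> v (y \<ominus> s n) + v (s n \<ominus> l)" for n
      using v_triangle[OF y _ lR] s(1) W(1) by blast
    then have "v (y \<ominus> l) \<le> 0 + 0"
      by (intro LIMSEQ_le_const[OF tendsto_add[OF s(2) l(2)]]) blast
    then have "v (y \<ominus> l) = 0" using v_nonneg[of "y \<ominus> l"] y lR by simp
    then have "y = l" using v_eq_0_iff[of "y \<ominus> l"] y lR by (simp add: r_right_minus_eq)
    then show "y \<in> W" using l(1) by simp
  qed
qed (rule W(1))

lemma (in ring) Span_subset_subring:
  assumes "subring D R" "K \<subseteq> D" "set Us \<subseteq> D"
  shows "Span K Us \<subseteq> D"
  using assms(3)
proof (induction Us)
  case Nil
  then show ?case using subringE(2)[OF assms(1)] by simp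
next
  case (Cons u Us)
  then show ?case
    using subringE(6,7)[OF assms(1)] assms(2) by (auto simp: line_extension_mem_iff subset_iff)
qed

text \<open>A basis of \<open>L\<close> over \<open>K\<close> spans a finite-dimensional subspace over the complete field \<open>k\<close>. It is
complete, hence closed, and it contains the dense image of \<open>L\<close>; so it is all of \<open>T\<close>. For
completions this says that \<open>Lh\<close> is finite over \<open>Kh\<close> and generated by \<open>L\<close>.\<close>
lemma finite_extension_of_dense_image:
  fixes F :: "('a, 'm) ring_scheme" and T :: "('b, 'n) ring_scheme"
  assumes F: "field F" and K: "subfield K F" and L: "subfield L F" "K \<subseteq> L"
    and fin: "ring.finite_dimension F K L"
    and T: "valued_domain T v" and k: "subfield k T" "complete_in T k v"
    and a: "a \<in> ring_hom (F\<lparr>carrier := L\<rparr>) T" "a ` K \<subseteq> k"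
    and dense: "\<And>y e. y \<in> carrier T \<Longrightarrow> 0 < e \<Longrightarrow> \<exists>x\<in>L. v (y \<ominus>\<^bsub>T\<^esub> a x) < e"
  obtains Us where "set Us \<subseteq> a ` L" "ring.Span T k Us = carrier T"
proof -
  interpret F: field F by fact
  interpret T: valued_domain T v by fact
  interpret a: ring_hom_ring "F\<lparr>carrier := L\<rparr>" T a
    using F.subring_is_ring[OF subfieldE(1)[OF L(1)]] T.ring_axioms a(1) by (rule ring_hom_ringI2)
  obtain n where "F.dimension n K L" using fin by (auto simp: F.finite_dimension_def)
  then obtain Us where Us: "set Us \<subseteq> carrier F" "F.Span K Us = L"
    using F.exists_base[OF K] by blast
  have UsL: "set Us \<subseteq> L" using F.Span_base_incl[OF K Us(1)] Us(2) by simp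
  have aT: "a x \<in> carrier T" if "x \<in> L" for x using a.hom_closed that by simp
  have "a ` F.Span K Vs \<subseteq> T.Span k (map a Vs)" if "set Vs \<subseteq> L" for Vs
    using that
  proof (induction Vs)
    case Nil
    then show ?case using a.hom_zero by simp
  next
    case (Cons u Vs)
    have VL: "F.Span K Vs \<subseteq> L"
      using F.Span_subset_subring[OF subfieldE(1)[OF L(1)] L(2)] Cons.prems by simp
    show ?case
    proof
      fix y assume "y \<in> a ` F.Span K (u # Vs)"
      then obtain c w where cw: "c \<in> K" "w \<in> F.Span K Vs" "y = a (c \<otimes>\<^bsub>F\<^esub> u \<oplus>\<^bsub>F\<^esub> w)"
        by (auto simp: F.line_extension_mem_iff)
      have m: "c \<in> L" "u \<in> L" "w \<in> L" using cw L(2) VL Cons.prems by auto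
      have "y = a c \<otimes>\<^bsub>T\<^esub> a u \<oplus>\<^bsub>T\<^esub> a w"
        using a.hom_add[of "c \<otimes>\<^bsub>F\<^esub> u" w] a.hom_mult[of c u] m
          subringE(6)[OF subfieldE(1)[OF L(1)] m(1,2)] cw(3) by simp
      moreover have "a w \<in> T.Span k (map a Vs)" using Cons.IH Cons.prems cw(2) by auto
      ultimately show "y \<in> T.Span k (map a (u # Vs))"
        using cw(1) a(2) by (auto simp: T.line_extension_mem_iff)
    qed
  qed
  then have aL: "a ` L \<subseteq> T.Span k (map a Us)" using UsL Us(2) by blast
  let ?W = "T.Span k (map a Us)"
  have aUs: "set (map a Us) \<subseteq> carrier T" using UsL aT by auto
  have "T.finite_dimension k ?W" by (rule T.Span_finite_dimension[OF k(1) aUs])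
  then obtain m where m: "T.dimension m k ?W" unfolding T.finite_dimension_def by blast
  have WT: "?W \<subseteq> carrier T" using T.space_subgroup_props(1)[OF k(1) m] .
  have "normed_subspace T k v (carrier T) v"
    using T.absolute_value_normed_subspace[OF k(1) T.carrier_is_subring subfieldE(3)[OF k(1)]] T.abs_val
    by simp
  then have "normed_subspace T k v ?W v"
    using T.normed_subspace_subset[OF _ m WT] by blast
  then have "complete_in T ?W v" using T.finite_dimension_complete[OF k(2) m] by blast
  moreover have "\<exists>z\<in>?W. v (y \<ominus>\<^bsub>T\<^esub> z) < e" if ye: "y \<in> carrier T" "0 < e" for y e
  proof -
    obtain x where "x \<in> L" "v (y \<ominus>\<^bsub>T\<^esub> a x) < e" using dense[OF ye] by blast
    then show ?thesis using aL by blast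
  qed
  ultimately have "?W = carrier T" using T.complete_dense_eq[OF WT] by presburger
  moreover have "set (map a Us) \<subseteq> a ` L" using UsL by auto
  ultimately show thesis using that by blast
qed

section \<open>Common extensions of two absolute values\<close>

locale composite_setting =
  fixes F :: "('a, 'm) ring_scheme" and K L M :: "'a set"
    and vK vL vM :: "'a \<Rightarrow> real"
    and Kh :: "('k, 'mk) ring_scheme" and vKh :: "'k \<Rightarrow> real" and \<iota>K :: "'a \<Rightarrow> 'k"
    and Lh :: "('l, 'ml) ring_scheme" and vLh :: "'l \<Rightarrow> real" and \<iota>L :: "'a \<Rightarrow> 'l"
    and Mh :: "('h, 'mh) ring_scheme" and vMh :: "'h \<Rightarrow> real" and \<iota>M :: "'a \<Rightarrow> 'h"
    and \<kappa>L :: "'k \<Rightarrow> 'l" and \<kappa>M :: "'k \<Rightarrow> 'h"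
    and \<Omega> :: "('o, 'mo) ring_scheme" and j :: "'h \<Rightarrow> 'o" and v\<Omega> :: "'o \<Rightarrow> real"
  assumes F: "field F"
    and K: "subfield K F" and L: "subfield L F" and M: "subfield M F" and KL: "K \<subseteq> L" and KM: "K \<subseteq> M"
    and finite_L_K: "ring.finite_dimension F K L"
    and finite_F_M: "ring.finite_dimension F M (carrier F)"
    and compl_K: "is_completion (F\<lparr>carrier := K\<rparr>) vK Kh vKh \<iota>K"
    and compl_L: "is_completion (F\<lparr>carrier := L\<rparr>) vL Lh vLh \<iota>L"
    and compl_M: "is_completion (F\<lparr>carrier := M\<rparr>) vM Mh vMh \<iota>M"
    and \<kappa>L: "\<kappa>L \<in> algebra_embeddings K \<iota>K Kh \<iota>L Lh" "\<forall>c\<in>carrier Kh. vLh (\<kappa>L c) = vKh c"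
    and \<kappa>M: "\<kappa>M \<in> algebra_embeddings K \<iota>K Kh \<iota>M Mh" "\<forall>c\<in>carrier Kh. vMh (\<kappa>M c) = vKh c"
    and j: "j \<in> ring_hom Mh \<Omega>" and closure: "algebraic_closure \<Omega> (j ` carrier Mh)"
    and abs_\<Omega>: "absolute_value \<Omega> v\<Omega>" and \<Omega>_ext_Mh: "\<forall>c\<in>carrier Mh. v\<Omega> (j c) = vMh c"
begin

definition compatible_embeddings :: "('a \<Rightarrow> 'o) set" where
  "compatible_embeddings = {\<alpha> \<in> algebra_embeddings M id F (j \<circ> \<iota>M) \<Omega>.
          \<exists>\<beta>\<in>algebra_embeddings (carrier Kh) \<kappa>L Lh (j \<circ> \<kappa>M) \<Omega>. \<forall>x\<in>L. \<alpha> x = \<beta> (\<iota>L x)}"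

lemma fields: "field Kh" "field Lh" "field Mh" "field \<Omega>"
  using compl_K compl_L compl_M closure by (auto simp: is_completion_def algebraic_closure_def)

sublocale F: field F by (rule F)
sublocale \<Omega>: algebraic_closure \<Omega> "j ` carrier Mh" by (rule closure)
sublocale Kh: field Kh by (rule fields)
sublocale Lh: field Lh by (rule fields)
sublocale Mh: field Mh by (rule fields)

lemma valued: "valued_domain Lh vLh" "valued_domain Mh vMh" "valued_domain \<Omega> v\<Omega>"
  using compl_L compl_M abs_\<Omega> Lh.domain_axioms Mh.domain_axioms \<Omega>.domain_axioms
  by (auto simp: is_completion_def valued_domain_def valued_domain_axioms_def)

sublocale vLh: valued_domain Lh vLh by (rule valued)
sublocale vMh: valued_domain Mh vMh by (rule valued)
sublocale v\<Omega>: valued_domain \<Omega> v\<Omega> by (rule valued)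

lemma homs: "\<iota>K \<in> ring_hom (F\<lparr>carrier := K\<rparr>) Kh" "\<iota>L \<in> ring_hom (F\<lparr>carrier := L\<rparr>) Lh"
    "\<iota>M \<in> ring_hom (F\<lparr>carrier := M\<rparr>) Mh" "\<kappa>L \<in> ring_hom Kh Lh" "\<kappa>M \<in> ring_hom Kh Mh"
  using compl_K compl_L compl_M \<kappa>L \<kappa>M by (auto simp: is_completion_def algebra_embeddings_def)

sublocale j: ring_hom_ring Mh \<Omega> j
  using Mh.ring_axioms \<Omega>.ring_axioms j by (rule ring_hom_ringI2)
sublocale \<kappa>L: ring_hom_ring Kh Lh \<kappa>L
  using Kh.ring_axioms Lh.ring_axioms homs(4) by (rule ring_hom_ringI2)
sublocale \<kappa>M: ring_hom_ring Kh Mh \<kappa>M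
  using Kh.ring_axioms Mh.ring_axioms homs(5) by (rule ring_hom_ringI2)

lemma \<iota>_closed: "x \<in> K \<Longrightarrow> \<iota>K x \<in> carrier Kh" "x \<in> L \<Longrightarrow> \<iota>L x \<in> carrier Lh" "x \<in> M \<Longrightarrow> \<iota>M x \<in> carrier Mh"
  using ring_hom_closed[OF homs(1), of x] ring_hom_closed[OF homs(2), of x] ring_hom_closed[OF homs(3), of x]
  by simp_all

lemma \<iota>_isom: "x \<in> K \<Longrightarrow> vKh (\<iota>K x) = vK x" "x \<in> L \<Longrightarrow> vLh (\<iota>L x) = vL x" "x \<in> M \<Longrightarrow> vMh (\<iota>M x) = vM x"
  using compl_K compl_L compl_M by (auto simp: is_completion_def)

lemma \<kappa>_\<iota>: "x \<in> K \<Longrightarrow> \<kappa>L (\<iota>K x) = \<iota>L x" "x \<in> K \<Longrightarrow> \<kappa>M (\<iota>K x) = \<iota>M x"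
  using \<kappa>L \<kappa>M by (auto simp: algebra_embeddings_def)

lemma \<kappa>L_range: "subfield (\<kappa>L ` carrier Kh) Lh" "complete_in Lh (\<kappa>L ` carrier Kh) vLh"
  using \<kappa>L.img_is_subfield(2)[OF Kh.carrier_is_subfield] 
    \<kappa>L.complete_in_image[OF Kh.carrier_is_subring completion_complete_in[OF compl_K]] \<kappa>L(2)
  by auto

lemma j_range: "subfield (j ` carrier Mh) \<Omega>" "complete_in \<Omega> (j ` carrier Mh) v\<Omega>"
  using \<Omega>.subfield_axioms
    j.complete_in_image[OF Mh.carrier_is_subring completion_complete_in[OF compl_M]] \<Omega>_ext_Mh
  by auto

lemma Lh_finite:
  obtains Us where "set Us \<subseteq> \<iota>L ` L" "Lh.Span (\<kappa>L ` carrier Kh) Us = carrier Lh"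
proof -
  have "\<iota>L ` K \<subseteq> \<kappa>L ` carrier Kh"
    using \<kappa>_\<iota>(1) \<iota>_closed(1) by (metis image_eqI image_subsetI)
  moreover have "\<exists>x\<in>L. vLh (y \<ominus>\<^bsub>Lh\<^esub> \<iota>L x) < e" if "y \<in> carrier Lh" "0 < e" for y e
    using completion_dense[OF compl_L that] by simp
  ultimately show thesis
    using finite_extension_of_dense_image[OF F K L KL finite_L_K valued(1) \<kappa>L_range homs(2)] that by blast
qed

lemma Lh_algebraic:
  assumes "y \<in> carrier Lh"
  shows "(Lh.algebraic over (\<kappa>L ` carrier Kh)) y"
proof -
  obtain Us where Us: "set Us \<subseteq> \<iota>L ` L" "Lh.Span (\<kappa>L ` carrier Kh) Us = carrier Lh"
    by (rule Lh_finite)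
  have "set Us \<subseteq> carrier Lh" using Us(1) \<iota>_closed(2) by blast
  then have "Lh.finite_dimension (\<kappa>L ` carrier Kh) (carrier Lh)"
    using Lh.Span_finite_dimension[OF \<kappa>L_range(1)] Us(2) by metis
  then show ?thesis
    using Lh.finite_dimension_imp_algebraic[OF \<kappa>L_range(1) Lh.carrier_is_subring] assms by blast
qed

text \<open>Restricting the absolute value of \<open>\<Omega>\<close> along \<open>\<beta>\<close> extends the absolute value of the complete field
\<open>Kh\<close> to its algebraic extension \<open>Lh\<close>, and such an extension is unique.\<close>
lemma embedding_of_Lh_isometric:
  assumes \<beta>: "\<beta> \<in> algebra_embeddings (carrier Kh) \<kappa>L Lh (j \<circ> \<kappa>M) \<Omega>" and y: "y \<in> carrier Lh"
  shows "v\<Omega> (\<beta> y) = vLh y"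
proof -
  have hom: "\<beta> \<in> ring_hom Lh \<Omega>" and eq: "\<And>c. c \<in> carrier Kh \<Longrightarrow> \<beta> (\<kappa>L c) = j (\<kappa>M c)"
    using \<beta> by (auto simp: algebra_embeddings_def)
  have "v\<Omega> (\<beta> y) = vLh y" if "y \<in> \<kappa>L ` carrier Kh" for y
    using that eq \<Omega>_ext_Mh \<kappa>L(2) \<kappa>M(2) \<kappa>M.hom_closed by auto
  then show ?thesis
    using Lh.absolute_value_unique_on_algebraic[OF \<kappa>L_range Lh.carrier_is_subring, of vLh "\<lambda>y. v\<Omega> (\<beta> y)" y]
      absolute_value_pullback[OF fields(2,4) hom abs_\<Omega>] vLh.abs_val subfieldE(3)[OF \<kappa>L_range(1)]
      Lh_algebraic[OF y] y by simp
qed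

text \<open>Again by uniqueness of the extension, now from \<open>Mh\<close> to \<open>\<Omega>\<close>: conjugate embeddings induce the same
absolute value on \<open>F\<close>.\<close>
lemma automorphism_isometric:
  assumes \<sigma>: "\<sigma> \<in> algebra_automorphisms (carrier Mh) j \<Omega>" and y: "y \<in> carrier \<Omega>"
  shows "v\<Omega> (\<sigma> y) = v\<Omega> y"
proof -
  have hom: "\<sigma> \<in> ring_hom \<Omega> \<Omega>" and eq: "\<And>c. c \<in> carrier Mh \<Longrightarrow> \<sigma> (j c) = j c"
    using \<sigma> by (auto simp: algebra_automorphisms_def ring_iso_def)
  have "v\<Omega> (\<sigma> y) = v\<Omega> y" if "y \<in> j ` carrier Mh" for y using that eq by auto
  then show ?thesis
    using \<Omega>.absolute_value_unique_on_algebraic[OF j_range \<Omega>.carrier_is_subring, of v\<Omega> "\<lambda>y. v\<Omega> (\<sigma> y)" y]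
      absolute_value_pullback[OF fields(4,4) hom abs_\<Omega>] abs_\<Omega> subfieldE(3)[OF j_range(1)]
      \<Omega>.algebraic_extension[OF y] y by simp
qed

lemma compatible_embeddingsD:
  assumes "\<alpha> \<in> compatible_embeddings"
  shows "\<alpha> \<in> ring_hom F \<Omega>" "\<alpha> \<in> extensional (carrier F)"
    "x \<in> M \<Longrightarrow> \<alpha> x = j (\<iota>M x)" "x \<in> carrier F \<Longrightarrow> \<alpha> x \<in> carrier \<Omega>"
  using assms ring_hom_closed[of \<alpha> F \<Omega> x] by (auto simp: compatible_embeddings_def algebra_embeddings_def)

lemma compatible_embedding_restricts:
  assumes \<alpha>: "\<alpha> \<in> compatible_embeddings"
  shows "absolute_value F (\<lambda>x. v\<Omega> (\<alpha> x))" "x \<in> L \<Longrightarrow> v\<Omega> (\<alpha> x) = vL x" "x \<in> M \<Longrightarrow> v\<Omega> (\<alpha> x) = vM x"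
proof -
  show "absolute_value F (\<lambda>x. v\<Omega> (\<alpha> x))"
    by (rule absolute_value_pullback[OF F fields(4) compatible_embeddingsD(1)[OF \<alpha>] abs_\<Omega>])
  show "v\<Omega> (\<alpha> x) = vM x" if "x \<in> M"
    using compatible_embeddingsD(3)[OF \<alpha> that] \<Omega>_ext_Mh \<iota>_closed(3)[OF that] \<iota>_isom(3)[OF that] by simp
  show "v\<Omega> (\<alpha> x) = vL x" if x: "x \<in> L"
  proof -
    obtain \<beta> where "\<beta> \<in> algebra_embeddings (carrier Kh) \<kappa>L Lh (j \<circ> \<kappa>M) \<Omega>" "\<alpha> x = \<beta> (\<iota>L x)"
      using \<alpha> x by (auto simp: compatible_embeddings_def)
    then show ?thesis
      using embedding_of_Lh_isometric \<iota>_closed(2)[OF x] \<iota>_isom(2)[OF x] by simp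
  qed
qed

lemma approximate_Mh:
  assumes "c \<in> carrier Mh" "0 < (e::real)"
  obtains m where "m \<in> M" "vMh (c \<ominus>\<^bsub>Mh\<^esub> \<iota>M m) < e"
  using completion_dense[OF compl_M assms] that by auto

text \<open>The correspondence \<open>\<alpha> x \<mapsto> \<alpha>' x\<close> is an isometry, so it extends to the closure \<open>D\<close> of \<open>\<alpha>(F)\<close> in \<open>\<Omega>\<close>
as far as limits exist. There it fixes \<open>Mh\<close>, because \<open>M\<close> is dense in \<open>Mh\<close> and both embeddings agree
on \<open>M\<close>. By the extension theorem for algebraic extensions it extends further to an endomorphism of
\<open>\<Omega>\<close> over \<open>Mh\<close>, which is an automorphism.\<close>
lemma same_absolute_value_imp_conjugate:
  assumes \<alpha>: "\<alpha> \<in> compatible_embeddings" and \<alpha>': "\<alpha>' \<in> compatible_embeddings"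
    and eq: "\<And>x. x \<in> carrier F \<Longrightarrow> v\<Omega> (\<alpha> x) = v\<Omega> (\<alpha>' x)"
  shows "\<exists>\<sigma>\<in>algebra_automorphisms (carrier Mh) j \<Omega>. \<forall>x\<in>carrier F. \<alpha>' x = \<sigma> (\<alpha> x)"
proof -
  obtain D \<tau> where D: "subring D \<Omega>" and \<tau>: "\<tau> \<in> ring_hom (\<Omega>\<lparr>carrier := D\<rparr>) \<Omega>"
    and \<tau>\<alpha>: "\<And>x. x \<in> carrier F \<Longrightarrow> \<alpha> x \<in> D \<and> \<tau> (\<alpha> x) = \<alpha>' x"
    and limit: "\<And>p q. p \<in> carrier \<Omega> \<Longrightarrow> q \<in> carrier \<Omega> \<Longrightarrow>
      \<forall>e>0. \<exists>x\<in>carrier F. v\<Omega> (p \<ominus>\<^bsub>\<Omega>\<^esub> \<alpha> x) < e \<and> v\<Omega> (q \<ominus>\<^bsub>\<Omega>\<^esub> \<alpha>' x) < e \<Longrightarrow> p \<in> D \<and> \<tau> p = q"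
    using isometric_extension_to_closure[OF F.ring_axioms valued(3,3) compatible_embeddingsD(1)[OF \<alpha>] compatible_embeddingsD(1)[OF \<alpha>'] eq]
    by metis
  have j_D: "j c \<in> D \<and> \<tau> (j c) = j c" if c: "c \<in> carrier Mh" for c
  proof (rule limit)
    show "\<forall>e>0. \<exists>x\<in>carrier F. v\<Omega> (j c \<ominus>\<^bsub>\<Omega>\<^esub> \<alpha> x) < e \<and> v\<Omega> (j c \<ominus>\<^bsub>\<Omega>\<^esub> \<alpha>' x) < e"
    proof (intro allI impI)
      fix e :: real assume "0 < e"
      then obtain m where m: "m \<in> M" "vMh (c \<ominus>\<^bsub>Mh\<^esub> \<iota>M m) < e" using approximate_Mh[OF c] by blast
      have "v\<Omega> (j c \<ominus>\<^bsub>\<Omega>\<^esub> j (\<iota>M m)) < e"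
        using j.hom_minus[OF c \<iota>_closed(3)[OF m(1)]] \<Omega>_ext_Mh Mh.minus_closed[OF c \<iota>_closed(3)[OF m(1)]] m(2)
        by metis
      then show "\<exists>x\<in>carrier F. v\<Omega> (j c \<ominus>\<^bsub>\<Omega>\<^esub> \<alpha> x) < e \<and> v\<Omega> (j c \<ominus>\<^bsub>\<Omega>\<^esub> \<alpha>' x) < e"
        using compatible_embeddingsD(3)[OF \<alpha> m(1)] compatible_embeddingsD(3)[OF \<alpha>' m(1)] subsetD[OF subfieldE(3)[OF M] m(1)]
        by (intro bexI[of _ m]) simp_all
    qed
  qed (use c in simp_all)
  have alg: "(\<Omega>.algebraic over (j ` carrier Mh)) x" if "x \<in> carrier \<Omega>" for x
    using \<Omega>.algebraic_extension[OF that] .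
  have jD: "j ` carrier Mh \<subseteq> D" using j_D by blast
  have D_field: "subfield D \<Omega>"
    using \<Omega>.subring_of_algebraic_is_subfield[OF j_range(1) D jD] alg subringE(1)[OF D] by blast
  obtain D' \<sigma> where D': "subfield D' \<Omega>" and \<sigma>: "\<sigma> \<in> ring_hom (\<Omega>\<lparr>carrier := D'\<rparr>) \<Omega>"
    and \<sigma>\<tau>: "\<And>x. x \<in> D \<Longrightarrow> \<sigma> x = \<tau> x"
    and all: "\<And>x. x \<in> carrier \<Omega> \<Longrightarrow> (\<Omega>.algebraic over D) x \<Longrightarrow> x \<in> D'"
    using hom_extends_to_algebraic_elements[OF \<Omega>.domain_axioms \<Omega>.algebraically_closed_axioms D_field \<tau>]
    by metis
  have "D' = carrier \<Omega>"
    using all \<Omega>.algebraic_mono[OF jD alg] subfieldE(3)[OF D'] by blast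
  then have "\<sigma> \<in> ring_hom \<Omega> \<Omega>" using \<sigma> by simp
  moreover have \<sigma>j: "\<sigma> (j c) = j c" if "c \<in> carrier Mh" for c
    using \<sigma>\<tau> j_D[OF that] by simp
  ultimately have "\<sigma> \<in> ring_iso \<Omega> \<Omega>"
    using \<Omega>.algebraic_endomorphism_is_automorphism[OF j_range(1) alg] by blast
  then have "\<sigma> \<in> algebra_automorphisms (carrier Mh) j \<Omega>"
    using \<sigma>j by (simp add: algebra_automorphisms_def)
  moreover have "\<forall>x\<in>carrier F. \<alpha>' x = \<sigma> (\<alpha> x)" using \<sigma>\<tau> \<tau>\<alpha> by simp
  ultimately show ?thesis by blast
qed

text \<open>The isometry \<open>\<iota>L x \<mapsto> \<alpha> x\<close> extends to every limit that exists on both sides. This includes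
\<open>Kh\<close>, where the partner of \<open>\<kappa>L c\<close> is \<open>j (\<kappa>M c)\<close>, and hence all of \<open>Lh\<close>, which is spanned by \<open>L\<close> over
\<open>Kh\<close>.\<close>
lemma Lh_embedding_of_isometry:
  assumes \<alpha>: "\<alpha> \<in> ring_hom (F\<lparr>carrier := L\<rparr>) \<Omega>" and \<alpha>K: "\<And>x. x \<in> K \<Longrightarrow> \<alpha> x = j (\<iota>M x)"
    and isom: "\<And>x. x \<in> L \<Longrightarrow> v\<Omega> (\<alpha> x) = vL x"
  shows "\<exists>\<beta>\<in>algebra_embeddings (carrier Kh) \<kappa>L Lh (j \<circ> \<kappa>M) \<Omega>. \<forall>x\<in>L. \<alpha> x = \<beta> (\<iota>L x)"
proof -
  have eq: "vLh (\<iota>L x) = v\<Omega> (\<alpha> x)" if "x \<in> carrier (F\<lparr>carrier := L\<rparr>)" for x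
    using that isom \<iota>_isom(2) by simp
  obtain D \<tau> where D: "subring D Lh" and \<tau>: "\<tau> \<in> ring_hom (Lh\<lparr>carrier := D\<rparr>) \<Omega>"
    and \<tau>\<alpha>': "\<And>x. x \<in> carrier (F\<lparr>carrier := L\<rparr>) \<Longrightarrow> \<iota>L x \<in> D \<and> \<tau> (\<iota>L x) = \<alpha> x"
    and limit: "\<And>p q. p \<in> carrier Lh \<Longrightarrow> q \<in> carrier \<Omega> \<Longrightarrow>
      \<forall>e>0. \<exists>x\<in>carrier (F\<lparr>carrier := L\<rparr>). vLh (p \<ominus>\<^bsub>Lh\<^esub> \<iota>L x) < e \<and> v\<Omega> (q \<ominus>\<^bsub>\<Omega>\<^esub> \<alpha> x) < e \<Longrightarrow> p \<in> D \<and> \<tau> p = q"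
    using isometric_extension_to_closure[OF F.subring_is_ring[OF subfieldE(1)[OF L]] valued(1,3) homs(2) \<alpha> eq]
    by metis
  have \<tau>\<alpha>: "\<iota>L x \<in> D \<and> \<tau> (\<iota>L x) = \<alpha> x" if "x \<in> L" for x using \<tau>\<alpha>' that by simp
  have \<kappa>_D: "\<kappa>L c \<in> D \<and> \<tau> (\<kappa>L c) = j (\<kappa>M c)" if c: "c \<in> carrier Kh" for c
  proof (rule limit)
    show "\<forall>e>0. \<exists>x\<in>carrier (F\<lparr>carrier := L\<rparr>). vLh (\<kappa>L c \<ominus>\<^bsub>Lh\<^esub> \<iota>L x) < e \<and> v\<Omega> (j (\<kappa>M c) \<ominus>\<^bsub>\<Omega>\<^esub> \<alpha> x) < e"
    proof (intro allI impI)
      fix e :: real assume "0 < e"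
      then obtain x where "x \<in> carrier (F\<lparr>carrier := K\<rparr>)" and le: "vKh (c \<ominus>\<^bsub>Kh\<^esub> \<iota>K x) < e"
        using completion_dense[OF compl_K c] by blast
      then have x: "x \<in> K" by simp
      note ix = \<iota>_closed(1)[OF x]
      have d: "c \<ominus>\<^bsub>Kh\<^esub> \<iota>K x \<in> carrier Kh" using c ix by simp
      have "vLh (\<kappa>L c \<ominus>\<^bsub>Lh\<^esub> \<iota>L x) = vKh (c \<ominus>\<^bsub>Kh\<^esub> \<iota>K x)"
        using \<kappa>L.hom_minus[OF c ix] \<kappa>L(2) d \<kappa>_\<iota>(1)[OF x] by metis
      moreover have "v\<Omega> (j (\<kappa>M c) \<ominus>\<^bsub>\<Omega>\<^esub> \<alpha> x) = vKh (c \<ominus>\<^bsub>Kh\<^esub> \<iota>K x)"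
      proof -
        have "j (\<kappa>M c) \<ominus>\<^bsub>\<Omega>\<^esub> \<alpha> x = j (\<kappa>M (c \<ominus>\<^bsub>Kh\<^esub> \<iota>K x))"
          using \<kappa>M.hom_minus[OF c ix] j.hom_minus[OF \<kappa>M.hom_closed[OF c] \<kappa>M.hom_closed[OF ix]]
            \<kappa>_\<iota>(2)[OF x] \<alpha>K[OF x] by simp
        then show ?thesis using \<Omega>_ext_Mh \<kappa>M(2) \<kappa>M.hom_closed[OF d] d by simp
      qed
      ultimately show "\<exists>x\<in>carrier (F\<lparr>carrier := L\<rparr>). vLh (\<kappa>L c \<ominus>\<^bsub>Lh\<^esub> \<iota>L x) < e \<and> v\<Omega> (j (\<kappa>M c) \<ominus>\<^bsub>\<Omega>\<^esub> \<alpha> x) < e"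
        using le subsetD[OF KL x] by (intro bexI[of _ x]) simp_all
    qed
  qed (use c \<kappa>L.hom_closed \<kappa>M.hom_closed in simp_all)
  obtain Us where Us: "set Us \<subseteq> \<iota>L ` L" "Lh.Span (\<kappa>L ` carrier Kh) Us = carrier Lh"
    by (rule Lh_finite)
  have "carrier Lh \<subseteq> D"
    using Lh.Span_subset_subring[OF D, of "\<kappa>L ` carrier Kh" Us] Us \<tau>\<alpha> \<kappa>_D by blast
  then have "D = carrier Lh" using subringE(1)[OF D] by blast
  then have "\<tau> \<in> ring_hom Lh \<Omega>" using \<tau> by simp
  then have "restrict \<tau> (carrier Lh) \<in> algebra_embeddings (carrier Kh) \<kappa>L Lh (j \<circ> \<kappa>M) \<Omega>"
    using \<kappa>_D \<kappa>L.hom_closed by (auto simp: algebra_embeddings_def ring_hom_def Pi_def)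
  moreover have "\<forall>x\<in>L. \<alpha> x = restrict \<tau> (carrier Lh) (\<iota>L x)"
    using \<tau>\<alpha> \<iota>_closed(2) by simp
  ultimately show ?thesis by blast
qed

text \<open>An element \<open>c\<close> of \<open>Mh\<close> is the limit of a sequence in \<open>M\<close>. It is a Cauchy sequence for the
absolute value \<open>v\<close> of \<open>F\<close>, which extends that of \<open>M\<close>, so it has a limit in \<open>C\<close> as well; this limit is
the image of \<open>c\<close>.\<close>
lemma Mh_embeds_into_completion:
  assumes v: "absolute_value F v" "\<And>x. x \<in> M \<Longrightarrow> v x = vM x"
    and C: "valued_domain C w" and i: "i \<in> ring_hom F C" and isom: "\<And>x. x \<in> carrier F \<Longrightarrow> w (i x) = v x"
    and lim: "\<And>s. cauchy_in F (carrier F) v s \<Longrightarrow> \<exists>l\<in>carrier C. (\<lambda>n. w (i (s n) \<ominus>\<^bsub>C\<^esub> l)) \<longlonglongrightarrow> 0"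
  obtains \<gamma> where "\<gamma> \<in> ring_hom Mh C" "\<And>x. x \<in> M \<Longrightarrow> \<gamma> (\<iota>M x) = i x"
    "\<And>c. c \<in> carrier Mh \<Longrightarrow> w (\<gamma> c) = vMh c"
proof -
  interpret C: valued_domain C w by fact
  have MF: "M \<subseteq> carrier F" using subfieldE(3)[OF M] .
  have Mr: "ring (F\<lparr>carrier := M\<rparr>)" using F.subring_is_ring[OF subfieldE(1)[OF M]] .
  have iM: "i \<in> ring_hom (F\<lparr>carrier := M\<rparr>) C"
    using ring_hom_restrict[OF i MF] .
  have eq: "vMh (\<iota>M x) = w (i x)" if "x \<in> carrier (F\<lparr>carrier := M\<rparr>)" for x
    using that \<iota>_isom(3) v(2) isom MF by auto
  obtain D \<gamma> where D: "subring D Mh" and \<gamma>: "\<gamma> \<in> ring_hom (Mh\<lparr>carrier := D\<rparr>) C"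
    and \<gamma>\<iota>: "\<And>x. x \<in> carrier (F\<lparr>carrier := M\<rparr>) \<Longrightarrow> \<iota>M x \<in> D \<and> \<gamma> (\<iota>M x) = i x"
    and \<gamma>_isom: "\<And>p. p \<in> D \<Longrightarrow> w (\<gamma> p) = vMh p"
    and limit: "\<And>p q. p \<in> carrier Mh \<Longrightarrow> q \<in> carrier C \<Longrightarrow>
      \<forall>e>0. \<exists>x\<in>carrier (F\<lparr>carrier := M\<rparr>). vMh (p \<ominus>\<^bsub>Mh\<^esub> \<iota>M x) < e \<and> w (q \<ominus>\<^bsub>C\<^esub> i x) < e \<Longrightarrow> p \<in> D \<and> \<gamma> p = q"
    by (rule isometric_extension_to_closure[OF Mr valued(2) C homs(3) iM eq]) (assumption, rule that)
  have "c \<in> D" if c: "c \<in> carrier Mh" for c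
  proof -
    have "\<exists>x\<in>M. vMh (c \<ominus>\<^bsub>Mh\<^esub> \<iota>M x) < e" if "0 < e" for e
      using approximate_Mh[OF c that] by metis
    moreover have "0 \<le> vMh (c \<ominus>\<^bsub>Mh\<^esub> \<iota>M x)" if "x \<in> M" for x
      using vMh.v_nonneg c \<iota>_closed(3)[OF that] by simp
    ultimately obtain s where s: "\<And>n. s n \<in> M" "(\<lambda>n. vMh (c \<ominus>\<^bsub>Mh\<^esub> \<iota>M (s n))) \<longlonglongrightarrow> 0"
      using null_sequence_of_approximations[of M "\<lambda>x. vMh (c \<ominus>\<^bsub>Mh\<^esub> \<iota>M x)"] by metis
    have sF: "s n \<in> carrier F" for n using s(1) MF by blast
    have "cauchy_in Mh (carrier Mh) vMh (\<lambda>n. \<iota>M (s n))"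
      using vMh.cauchy_if_convergent[OF _ subset_refl c s(2)] \<iota>_closed(3) s(1) by blast
    moreover have "vMh (\<iota>M (s m) \<ominus>\<^bsub>Mh\<^esub> \<iota>M (s n)) = v (s m \<ominus>\<^bsub>F\<^esub> s n)" for m n
      using hom_minus_on_subring[OF F.ring_axioms Mh.ring_axioms subfieldE(1)[OF M] homs(3) s(1) s(1), of m n]
        \<iota>_isom(3) v(2) F.subring_minus[OF subfieldE(1)[OF M] s(1) s(1), of m n] by metis
    ultimately have "cauchy_in F (carrier F) v s"
      using sF by (simp add: cauchy_in_def)
    then obtain l where l: "l \<in> carrier C" "(\<lambda>n. w (i (s n) \<ominus>\<^bsub>C\<^esub> l)) \<longlonglongrightarrow> 0" using lim by blast
    have "\<exists>x\<in>carrier (F\<lparr>carrier := M\<rparr>). vMh (c \<ominus>\<^bsub>Mh\<^esub> \<iota>M x) < e \<and> w (l \<ominus>\<^bsub>C\<^esub> i x) < e" if "0 < e" for e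
    proof -
      have "eventually (\<lambda>n. vMh (c \<ominus>\<^bsub>Mh\<^esub> \<iota>M (s n)) < e \<and> w (i (s n) \<ominus>\<^bsub>C\<^esub> l) < e) sequentially"
        using order_tendstoD(2)[OF s(2) that] order_tendstoD(2)[OF l(2) that] by (rule eventually_conj)
      then obtain n where "vMh (c \<ominus>\<^bsub>Mh\<^esub> \<iota>M (s n)) < e" "w (i (s n) \<ominus>\<^bsub>C\<^esub> l) < e"
        by (auto simp: eventually_sequentially)
      then show ?thesis
        using s(1)[of n] C.v_minus_commute[OF l(1) ring_hom_closed[OF i sF], of n] by auto
    qed
    then show ?thesis using limit[OF c l(1)] by blast
  qed
  then have "D = carrier Mh" using subringE(1)[OF D] by blast
  then show thesis using that[of \<gamma>] \<gamma> \<gamma>\<iota> \<gamma>_isom by simp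
qed

text \<open>Inside a domain \<open>C\<close> with the limits of the Cauchy sequences of \<open>F\<close>, both \<open>F\<close> and \<open>Mh\<close> are embedded
isometrically. As \<open>F\<close> is finite over \<open>M\<close>, its image is algebraic over \<open>Mh\<close>, so the embedding of \<open>Mh\<close>
into \<open>\<Omega>\<close> extends to it. The result is isometric on \<open>F\<close> by uniqueness of the extension of absolute
values from \<open>Mh\<close>. Its restriction to \<open>L\<close> is then isometric for \<open>vL\<close>, which gives the embedding
of \<open>Lh\<close>.\<close>
lemma extension_is_realized:
  assumes v: "absolute_value F v" "\<And>x. x \<in> L \<Longrightarrow> v x = vL x" "\<And>x. x \<in> M \<Longrightarrow> v x = vM x"
  shows "\<exists>\<alpha>\<in>compatible_embeddings. \<forall>x\<in>carrier F. v\<Omega> (\<alpha> x) = v x"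
proof -
  interpret vF: valued_domain F v
    using v(1) by (simp add: valued_domain_def valued_domain_axioms_def F.domain_axioms)
  obtain C :: "(nat \<Rightarrow> 'a) set ring" and w i where C: "valued_domain C w" and i: "i \<in> ring_hom F C"
    and isom: "\<And>x. x \<in> carrier F \<Longrightarrow> w (i x) = v x"
    and lim: "\<And>s. cauchy_in F (carrier F) v s \<Longrightarrow> \<exists>l\<in>carrier C. (\<lambda>n. w (i (s n) \<ominus>\<^bsub>C\<^esub> l)) \<longlonglongrightarrow> 0"
    using vF.exists_domain_of_Cauchy_limits by blast
  interpret C: valued_domain C w by fact
  obtain \<gamma> where \<gamma>: "\<gamma> \<in> ring_hom Mh C" and \<gamma>\<iota>: "\<And>x. x \<in> M \<Longrightarrow> \<gamma> (\<iota>M x) = i x"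
    and \<gamma>_isom: "\<And>c. c \<in> carrier Mh \<Longrightarrow> w (\<gamma> c) = vMh c"
    using Mh_embeds_into_completion[OF v(1) v(3) C i isom lim] by metis
  interpret i: ring_hom_ring F C i using F.ring_axioms C.ring_axioms i by (rule ring_hom_ringI2)
  interpret \<gamma>: ring_hom_ring Mh C \<gamma> using Mh.ring_axioms C.ring_axioms \<gamma> by (rule ring_hom_ringI2)
  let ?k = "\<gamma> ` carrier Mh"
  have k: "subfield ?k C" and \<gamma>_inj: "inj_on \<gamma> (carrier Mh)"
    using \<gamma>.img_is_subfield[OF Mh.carrier_is_subfield C.one_not_zero] by blast+
  have k_compl: "complete_in C ?k w"
    using \<gamma>.complete_in_image[OF Mh.carrier_is_subring completion_complete_in[OF compl_M] \<gamma>_isom] .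
  have "inv_into (carrier Mh) \<gamma> \<in> ring_hom (C\<lparr>carrier := ?k\<rparr>) Mh"
    using \<gamma>.inv_ring_hom[OF \<gamma>_inj Mh.carrier_is_subring] by (simp add: ring_hom_ring_def ring_hom_ring_axioms_def)
  then have h: "j \<circ> inv_into (carrier Mh) \<gamma> \<in> ring_hom (C\<lparr>carrier := ?k\<rparr>) \<Omega>"
    using ring_hom_trans j by blast
  obtain D H where D: "subfield D C" and H: "H \<in> ring_hom (C\<lparr>carrier := D\<rparr>) \<Omega>" and kD: "?k \<subseteq> D"
    and Hk: "\<And>x. x \<in> ?k \<Longrightarrow> H x = (j \<circ> inv_into (carrier Mh) \<gamma>) x"
    and alg_D: "\<And>x. x \<in> carrier C \<Longrightarrow> (C.algebraic over ?k) x \<Longrightarrow> x \<in> D"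
    by (rule hom_extends_to_algebraic_elements[OF C.domain_axioms \<Omega>.algebraically_closed_axioms k h])
      (rule that)
  have H\<gamma>: "H (\<gamma> c) = j c" if "c \<in> carrier Mh" for c
    using Hk[of "\<gamma> c"] that \<gamma>_inj by simp
  have alg: "(C.algebraic over ?k) (i x)" if x: "x \<in> carrier F" for x
  proof -
    have "(F.algebraic over M) x"
      using F.finite_dimension_imp_algebraic[OF M F.carrier_is_subring finite_F_M x] .
    then have "(C.algebraic over (i ` M)) (i x)"
      using algebraic_image[OF i.ring_hom_ring_axioms F.domain_axioms M C.one_not_zero x] by blast
    moreover have "i ` M \<subseteq> ?k" using \<gamma>\<iota> \<iota>_closed(3) by (metis image_eqI image_subsetI)
    ultimately show ?thesis using C.algebraic_mono by blast
  qed
  have iD: "i x \<in> D" if "x \<in> carrier F" for x using alg_D alg i.hom_closed that by blast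
  have H_isom: "v\<Omega> (H (i x)) = v x" if x: "x \<in> carrier F" for x
  proof -
    have "absolute_value (C\<lparr>carrier := D\<rparr>) (\<lambda>y. v\<Omega> (H y))"
      using absolute_value_pullback[OF C.subfield_iff(2)[OF D] fields(4) H abs_\<Omega>] .
    moreover have "absolute_value (C\<lparr>carrier := D\<rparr>) w"
      using absolute_value_restrict[OF C.abs_val subfieldE(3)[OF D]] .
    moreover have "v\<Omega> (H y) = w y" if "y \<in> ?k" for y
      using that H\<gamma> \<Omega>_ext_Mh \<gamma>_isom by auto
    ultimately have "v\<Omega> (H (i x)) = w (i x)"
      using C.absolute_value_unique_on_algebraic[OF k k_compl subfieldE(1)[OF D] kD, of w "\<lambda>y. v\<Omega> (H y)" "i x"]
        iD[OF x] alg[OF x] by blast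
    then show ?thesis using isom[OF x] by simp
  qed
  define \<alpha> where "\<alpha> = (\<lambda>x\<in>carrier F. H (i x))"
  have "i \<in> ring_hom F (C\<lparr>carrier := D\<rparr>)"
    using i iD by (auto simp: ring_hom_def)
  then have "H \<circ> i \<in> ring_hom F \<Omega>" using ring_hom_trans H by blast
  then have \<alpha>_hom: "\<alpha> \<in> ring_hom F \<Omega>"
    by (auto simp: \<alpha>_def ring_hom_def Pi_def)
  have MF: "M \<subseteq> carrier F" and LF: "L \<subseteq> carrier F" using subfieldE(3)[OF M] subfieldE(3)[OF L] by blast+
  have \<alpha>_M: "\<alpha> x = j (\<iota>M x)" if "x \<in> M" for x
    using that MF H\<gamma>[OF \<iota>_closed(3)[OF that]] \<gamma>\<iota>[OF that] by (auto simp: \<alpha>_def)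
  have \<alpha>_isom: "v\<Omega> (\<alpha> x) = v x" if "x \<in> carrier F" for x
    using H_isom[OF that] that by (simp add: \<alpha>_def)
  have "\<alpha> \<in> algebra_embeddings M id F (j \<circ> \<iota>M) \<Omega>"
    using \<alpha>_hom \<alpha>_M by (auto simp: algebra_embeddings_def \<alpha>_def)
  moreover have "\<alpha> \<in> ring_hom (F\<lparr>carrier := L\<rparr>) \<Omega>"
    using ring_hom_restrict[OF \<alpha>_hom LF] .
  then have "\<exists>\<beta>\<in>algebra_embeddings (carrier Kh) \<kappa>L Lh (j \<circ> \<kappa>M) \<Omega>. \<forall>x\<in>L. \<alpha> x = \<beta> (\<iota>L x)"
  proof (rule Lh_embedding_of_isometry)
    show "\<alpha> x = j (\<iota>M x)" if "x \<in> K" for x using \<alpha>_M that KM by blast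
    show "v\<Omega> (\<alpha> x) = vL x" if "x \<in> L" for x using \<alpha>_isom v(2) that LF by auto
  qed
  ultimately have "\<alpha> \<in> compatible_embeddings" by (simp add: compatible_embeddings_def)
  then show ?thesis using \<alpha>_isom by blast
qed

lemma equiv_conjugacy_compatible:
  "equiv compatible_embeddings (conjugacy (carrier F) (carrier Mh) j \<Omega> compatible_embeddings)"
proof (rule equiv_conjugacy[OF \<Omega>.ring_axioms])
  show "j ` carrier Mh \<subseteq> carrier \<Omega>" using subfieldE(3)[OF j_range(1)] .
qed (rule compatible_embeddingsD(4))

lemma conjugate_iff_same_absolute_value:
  assumes \<alpha>: "\<alpha> \<in> compatible_embeddings" and \<alpha>': "\<alpha>' \<in> compatible_embeddings"
  shows "(\<alpha>, \<alpha>') \<in> conjugacy (carrier F) (carrier Mh) j \<Omega> compatible_embeddings \<longleftrightarrow>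
    (\<forall>x\<in>carrier F. v\<Omega> (\<alpha> x) = v\<Omega> (\<alpha>' x))"
proof
  assume "(\<alpha>, \<alpha>') \<in> conjugacy (carrier F) (carrier Mh) j \<Omega> compatible_embeddings"
  then obtain \<sigma> where "\<sigma> \<in> algebra_automorphisms (carrier Mh) j \<Omega>" "\<forall>x\<in>carrier F. \<alpha>' x = \<sigma> (\<alpha> x)"
    by (auto simp: conjugacy_def)
  then show "\<forall>x\<in>carrier F. v\<Omega> (\<alpha> x) = v\<Omega> (\<alpha>' x)"
    using automorphism_isometric compatible_embeddingsD(4)[OF \<alpha>] by simp
next
  assume "\<forall>x\<in>carrier F. v\<Omega> (\<alpha> x) = v\<Omega> (\<alpha>' x)"
  then show "(\<alpha>, \<alpha>') \<in> conjugacy (carrier F) (carrier Mh) j \<Omega> compatible_embeddings"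
    using same_absolute_value_imp_conjugate[OF \<alpha> \<alpha>'] \<alpha> \<alpha>' by (auto simp: conjugacy_def)
qed

theorem canonical_bijection:
  defines "R \<equiv> conjugacy (carrier F) (carrier Mh) j \<Omega> compatible_embeddings"
  shows "\<exists>\<Phi>. bij_betw \<Phi> (compatible_embeddings // R)
               {v \<in> extensional (carrier F). absolute_value F v \<and>
                  (\<forall>x\<in>L. v x = vL x) \<and> (\<forall>x\<in>M. v x = vM x)} \<and>
             (\<forall>\<alpha>\<in>compatible_embeddings. \<Phi> (R `` {\<alpha>}) = (\<lambda>x\<in>carrier F. v\<Omega> (\<alpha> x)))"
proof -
  let ?V = "{v \<in> extensional (carrier F). absolute_value F v \<and>
                  (\<forall>x\<in>L. v x = vL x) \<and> (\<forall>x\<in>M. v x = vM x)}"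
  define g where "g \<alpha> = (\<lambda>x\<in>carrier F. v\<Omega> (\<alpha> x))" for \<alpha> :: "'a \<Rightarrow> 'o"
  \<comment> \<open>Members of one class have the same image under \<open>g\<close>, so any choice of \<open>\<alpha>\<close> will do.\<close>
  define \<Phi> where "\<Phi> c = g (SOME \<alpha>. \<alpha> \<in> c)" for c :: "('a \<Rightarrow> 'o) set"
  have equiv: "equiv compatible_embeddings R" using equiv_conjugacy_compatible by (simp add: R_def)
  have R_iff: "(\<alpha>, \<alpha>') \<in> R \<longleftrightarrow> g \<alpha> = g \<alpha>'" if "\<alpha> \<in> compatible_embeddings" "\<alpha>' \<in> compatible_embeddings" for \<alpha> \<alpha>'
  proof -
    have "g \<alpha> = g \<alpha>' \<longleftrightarrow> (\<forall>x\<in>carrier F. v\<Omega> (\<alpha> x) = v\<Omega> (\<alpha>' x))"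
      unfolding g_def by (auto simp: restrict_def fun_eq_iff)
    then show ?thesis using conjugate_iff_same_absolute_value[OF that] by (simp add: R_def)
  qed
  have \<Phi>: "\<Phi> (R `` {\<alpha>}) = g \<alpha>" if \<alpha>: "\<alpha> \<in> compatible_embeddings" for \<alpha>
  proof -
    let ?\<alpha>' = "SOME \<alpha>'. \<alpha>' \<in> R `` {\<alpha>}"
    have "?\<alpha>' \<in> R `` {\<alpha>}"
      by (rule someI[of _ \<alpha>]) (use equiv_class_self[OF equiv \<alpha>] in simp)
    then have "(\<alpha>, ?\<alpha>') \<in> R" by simp
    moreover from this have "?\<alpha>' \<in> compatible_embeddings" using equiv by (auto dest: equivE simp: equiv_def refl_on_def)
    ultimately show ?thesis using R_iff[OF \<alpha>] by (simp add: \<Phi>_def)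
  qed
  have "g \<alpha> \<in> ?V" if \<alpha>: "\<alpha> \<in> compatible_embeddings" for \<alpha>
  proof -
    have "absolute_value F (g \<alpha>)"
      using compatible_embedding_restricts(1)[OF \<alpha>] by (simp add: absolute_value_def g_def)
    moreover have "\<forall>x\<in>L. g \<alpha> x = vL x" "\<forall>x\<in>M. g \<alpha> x = vM x"
      using compatible_embedding_restricts(2,3)[OF \<alpha>] subfieldE(3)[OF L] subfieldE(3)[OF M] by (auto simp: g_def)
    ultimately show ?thesis by (simp add: g_def)
  qed
  moreover have "\<exists>\<alpha>\<in>compatible_embeddings. g \<alpha> = v" if "v \<in> ?V" for v
  proof -
    obtain \<alpha> where \<alpha>: "\<alpha> \<in> compatible_embeddings" "\<forall>x\<in>carrier F. v\<Omega> (\<alpha> x) = v x"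
      using extension_is_realized[of v] \<open>v \<in> ?V\<close> by blast
    have "g \<alpha> = v"
      using \<alpha>(2) \<open>v \<in> ?V\<close> by (auto simp: g_def restrict_def extensional_def fun_eq_iff)
    with \<alpha>(1) show ?thesis by blast
  qed
  ultimately have image: "g ` compatible_embeddings = ?V" by blast
  have "bij_betw \<Phi> (compatible_embeddings // R) ?V"
    unfolding bij_betw_def
  proof
    show "inj_on \<Phi> (compatible_embeddings // R)"
    proof (rule inj_onI)
      fix c c' assume "c \<in> compatible_embeddings // R" "c' \<in> compatible_embeddings // R" "\<Phi> c = \<Phi> c'"
      then obtain \<alpha> \<alpha>' where \<alpha>: "\<alpha> \<in> compatible_embeddings" "c = R `` {\<alpha>}" and \<alpha>': "\<alpha>' \<in> compatible_embeddings" "c' = R `` {\<alpha>'}"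
        by (auto elim!: quotientE)
      then have "g \<alpha> = g \<alpha>'" using \<open>\<Phi> c = \<Phi> c'\<close> \<Phi> by simp
      then have "(\<alpha>, \<alpha>') \<in> R" using R_iff \<alpha>(1) \<alpha>'(1) by blast
      then show "c = c'" using equiv_class_eq[OF equiv] \<alpha>(2) \<alpha>'(2) by simp
    qed
    show "\<Phi> ` (compatible_embeddings // R) = ?V"
      unfolding image[symmetric] quotient_def using \<Phi> by (auto simp: image_iff)
  qed
  then show ?thesis using \<Phi> unfolding g_def by blast
qed

end

theorem theorem1p3:
  fixes F :: "('a, 'm) ring_scheme" and K L M :: "'a set"
    and vK vL vM :: "'a \<Rightarrow> real"
    and Kh :: "('k, 'mk) ring_scheme" and vKh :: "'k \<Rightarrow> real" and \<iota>K :: "'a \<Rightarrow> 'k"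
    and Lh :: "('l, 'ml) ring_scheme" and vLh :: "'l \<Rightarrow> real" and \<iota>L :: "'a \<Rightarrow> 'l"
    and Mh :: "('h, 'mh) ring_scheme" and vMh :: "'h \<Rightarrow> real" and \<iota>M :: "'a \<Rightarrow> 'h"
    and \<kappa>L :: "'k \<Rightarrow> 'l" and \<kappa>M :: "'k \<Rightarrow> 'h"
    and \<Omega> :: "('o, 'mo) ring_scheme" and j :: "'h \<Rightarrow> 'o" and v\<Omega> :: "'o \<Rightarrow> real"
  assumes F: "field F"
    and subfields: "subfield K F" "subfield L F" "subfield M F" "K \<subseteq> L" "K \<subseteq> M"
    and finite_L_K: "ring.finite_dimension F K L"
    and finite_F_M: "ring.finite_dimension F M (carrier F)"
    and abs_K: "absolute_value (F\<lparr>carrier := K\<rparr>) vK"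
    and abs_L: "absolute_value (F\<lparr>carrier := L\<rparr>) vL" and L_ext_K: "\<forall>x\<in>K. vL x = vK x"
    and abs_M: "absolute_value (F\<lparr>carrier := M\<rparr>) vM" and M_ext_K: "\<forall>x\<in>K. vM x = vK x"
    \<comment> \<open>the completions\<close>
    and compl_K: "is_completion (F\<lparr>carrier := K\<rparr>) vK Kh vKh \<iota>K"
    and compl_L: "is_completion (F\<lparr>carrier := L\<rparr>) vL Lh vLh \<iota>L"
    and compl_M: "is_completion (F\<lparr>carrier := M\<rparr>) vM Mh vMh \<iota>M"
    \<comment> \<open>the absolute-value-preserving \<open>K\<close>-algebra embeddings of the completion of \<open>K\<close>\<close>
    and \<kappa>L: "\<kappa>L \<in> algebra_embeddings K \<iota>K Kh \<iota>L Lh" "\<forall>c\<in>carrier Kh. vLh (\<kappa>L c) = vKh c"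
    and \<kappa>M: "\<kappa>M \<in> algebra_embeddings K \<iota>K Kh \<iota>M Mh" "\<forall>c\<in>carrier Kh. vMh (\<kappa>M c) = vKh c"
    \<comment> \<open>an algebraic closure of the completion of \<open>M\<close>, with the extended absolute value\<close>
    and j: "j \<in> ring_hom Mh \<Omega>" and closure: "algebraic_closure \<Omega> (j ` carrier Mh)"
    and abs_\<Omega>: "absolute_value \<Omega> v\<Omega>" and \<Omega>_ext_Mh: "\<forall>c\<in>carrier Mh. v\<Omega> (j c) = vMh c"
  defines "E \<equiv> {\<alpha> \<in> algebra_embeddings M id F (j \<circ> \<iota>M) \<Omega>.
                  \<exists>\<beta>\<in>algebra_embeddings (carrier Kh) \<kappa>L Lh (j \<circ> \<kappa>M) \<Omega>.
                    \<forall>x\<in>L. \<alpha> x = \<beta> (\<iota>L x)}"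
  defines "R \<equiv> conjugacy (carrier F) (carrier Mh) j \<Omega> E"
  shows "\<exists>\<Phi>. bij_betw \<Phi> (E // R)
               {v \<in> extensional (carrier F). absolute_value F v \<and>
                  (\<forall>x\<in>L. v x = vL x) \<and> (\<forall>x\<in>M. v x = vM x)} \<and>
             (\<forall>\<alpha>\<in>E. \<Phi> (R `` {\<alpha>}) = (\<lambda>x\<in>carrier F. v\<Omega> (\<alpha> x)))"
proof -
  interpret S: composite_setting F K L M vK vL vM Kh vKh \<iota>K Lh vLh \<iota>L Mh vMh \<iota>M \<kappa>L \<kappa>M \<Omega> j v\<Omega>
    by (rule composite_setting.intro) (fact assms)+
  show ?thesis
    using S.canonical_bijection unfolding R_def E_def S.compatible_embeddings_def .
qed

end
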